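(* Let $F$ be a field of characteristic not $2$, let $(V,B)$ be a finite-dimensional symplectic vector space over $F$, and let $l_1,\ldots,l_n$ ($n\ge3$) be Lagrangian subspaces of $V$. Then $$\tau(l_1,l_2,\ldots,l_n)=\tau^{\mathrm{Kash}}(l_1,l_2,\ldots,l_n)$$ in the Witt group $W(F)$.
   Context: $W(F)$ is the Witt group of quadratic spaces (finite-dimensional $F$-vector spaces with a non-degenerate symmetric bilinear form). A possibly degenerate symmetric bilinear form on a finite-dimensional space represents the class of its quotient by the radical. Definition of $\tau$: $K_{1,\ldots,n}=\{w\in\bigoplus_{i\in\mathbb Z/n\mathbb Z} l_i:\sum_i w_i=0\}$. For $w\in K_{1,\ldots,n}$ an anti-derivative is a family $\hat w=(\hat w_{\{i,i+1\}})_{i\in\mathbb Z/n\mathbb Z}$ of elements of $V$ with $\hat w_{\{i,i+1\}}-\hat w_{\{i-1,i\}}=w_i$ for all $i$; it exists and is unique up to a constant vector. The symmetric form $q_{1,\ldots,n}(v,w)=\sum_iB(v_i,\hat w_{\{i,i+1\}})$ on $K_{1,\ldots,n}$ is independent of the choice of $\hat w$. Then $\tau(l_1,\ldots,l_n)$ is the class in $W(F)$ of the quadratic space $T_{1,\ldots,n}=K_{1,\ldots,n}/\ker q_{1,\ldots,n}$. Definition of Kashiwara's index $\tau^{\mathrm{Kash}}$: for $n=3$, $\tau^{\mathrm{Kash}}(l_1,l_2,l_3)$ is represented by the symmetric bilinear form on $l_1\oplus l_2\oplus l_3$ $$q^{\mathrm{Kash}}_{1,2,3}(v,w)=\tfrac12\big(B(v_1,w_2-w_3)+B(v_2,w_3-w_1)+B(v_3,w_1-w_2)\big).$$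 For general $n$ it is extended inductively by $$\tau^{\mathrm{Kash}}(l_1,\ldots,l_n):=\tau^{\mathrm{Kash}}(l_1,l_2,\ldots,l_k)+\tau^{\mathrm{Kash}}(l_1,l_k,\ldots,l_n)$$ for any $k\in\{3,\ldots,n-1\}$ (the result does not depend on the choices of $k$). *)

theory Defs
  imports
    "HOL-Library.Function_Algebras"
    "Jordan_Normal_Form.Matrix"
begin

section \<open>The Witt group of a field\<close>

text \<open>
  Up to isometry, a quadratic space is \<open>F\<^sup>n\<close> with the form \<open>(v, w) \<mapsto> v \<bullet> (A *\<^sub>v w)\<close> given by a
  symmetric invertible matrix \<open>A\<close>.  Such matrices represent the elements of \<open>W(F)\<close>; the class of a
  form on an arbitrary space is \<open>witt_class\<close> below.
\<close>

definition quadratic_mat :: "'a::field mat \<Rightarrow> bool" where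
  "quadratic_mat A \<longleftrightarrow> invertible_mat A \<and> transpose_mat A = A"

definition isometric :: "'a::field mat \<Rightarrow> 'a mat \<Rightarrow> bool" where
  "isometric A B \<longleftrightarrow>
     (\<exists>P \<in> carrier_mat (dim_row B) (dim_row A). \<exists>Q \<in> carrier_mat (dim_row A) (dim_row B).
        inverts_mat P Q \<and> inverts_mat Q P \<and> A = transpose_mat P * B * P)"

definition orth_sum :: "'a::field mat \<Rightarrow> 'a mat \<Rightarrow> 'a mat" where
  "orth_sum A B = four_block_mat A (0\<^sub>m (dim_row A) (dim_col B)) (0\<^sub>m (dim_row B) (dim_col A)) B"

text \<open>
  A quadratic space is metabolic if it contains a Lagrangian, i.e. an \<open>L\<close> with \<open>L = L\<^sup>\<bottom>\<close> (which
  forces \<open>L\<close> to be a subspace).  In characteristic other than 2 the metabolic spaces are exactly the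
  hyperbolic ones, i.e. the orthogonal sums of hyperbolic planes.
\<close>

definition metabolic :: "'a::field mat \<Rightarrow> bool" where
  "metabolic A \<longleftrightarrow> quadratic_mat A \<and>
     (\<exists>L. L = {v \<in> carrier_vec (dim_row A). \<forall>w\<in>L. v \<bullet> (A *\<^sub>v w) = 0})"

definition witt_equiv :: "'a::field mat \<Rightarrow> 'a mat \<Rightarrow> bool" where
  "witt_equiv A B \<longleftrightarrow> quadratic_mat A \<and> quadratic_mat B \<and>
     (\<exists>M N. metabolic M \<and> metabolic N \<and> isometric (orth_sum A M) (orth_sum B N))"

lemma quadratic_matE:
  assumes "quadratic_mat A"
  obtains n Q where "A \<in> carrier_mat n n" "Q \<in> carrier_mat n n" "A * Q = 1\<^sub>m n" "Q * A = 1\<^sub>m n"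
    "transpose_mat A = A"
proof -
  from assms obtain Q where sq: "square_mat A" and Q: "A * Q = 1\<^sub>m (dim_row A)" "Q * A = 1\<^sub>m (dim_row Q)"
    and t: "transpose_mat A = A"
    unfolding quadratic_mat_def invertible_mat_def inverts_mat_def by auto
  have "dim_col Q = dim_row A" "dim_row Q = dim_col A"
    using arg_cong[OF Q(1), of dim_col] arg_cong[OF Q(2), of dim_col] by auto
  with sq have c: "A \<in> carrier_mat (dim_row A) (dim_row A)" "Q \<in> carrier_mat (dim_row A) (dim_row A)"
    and r: "dim_row Q = dim_row A" by (auto intro!: carrier_matI)
  from that[OF c Q(1) Q(2)[unfolded r] t] show thesis .
qed

lemma quadratic_matI:
  assumes "A \<in> carrier_mat n n" "Q \<in> carrier_mat n n" "A * Q = 1\<^sub>m n" "Q * A = 1\<^sub>m n"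
    "transpose_mat A = A"
  shows "quadratic_mat A"
  using assms unfolding quadratic_mat_def invertible_mat_def inverts_mat_def by auto

lemma quadratic_mat_carrier: "quadratic_mat A \<Longrightarrow> A \<in> carrier_mat (dim_row A) (dim_row A)"
  by (auto elim: quadratic_matE)

lemma isometricI:
  assumes "P \<in> carrier_mat m n" "Q \<in> carrier_mat n m" "P * Q = 1\<^sub>m m" "Q * P = 1\<^sub>m n"
    "dim_row A = n" "dim_row B = m" "A = transpose_mat P * B * P"
  shows "isometric A B"
proof -
  have "dim_row P = m" "dim_row Q = n" using assms(1,2) by auto
  then have "inverts_mat P Q \<and> inverts_mat Q P \<and> A = transpose_mat P * B * P"
    unfolding inverts_mat_def using assms(3,4,7) by simp_all
  then show ?thesis
    unfolding isometric_def assms(5,6) by (intro bexI[OF bexI[OF _ assms(2)] assms(1)])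
qed

lemma isometricE:
  assumes "isometric A B"
  obtains P Q where "P \<in> carrier_mat (dim_row B) (dim_row A)" "Q \<in> carrier_mat (dim_row A) (dim_row B)"
    "P * Q = 1\<^sub>m (dim_row B)" "Q * P = 1\<^sub>m (dim_row A)" "A = transpose_mat P * B * P"
proof -
  from assms obtain P Q where P: "P \<in> carrier_mat (dim_row B) (dim_row A)"
    and Q: "Q \<in> carrier_mat (dim_row A) (dim_row B)"
    and PQ: "inverts_mat P Q" "inverts_mat Q P" and e: "A = transpose_mat P * B * P"
    unfolding isometric_def by blast
  have "dim_row P = dim_row B" "dim_row Q = dim_row A" using P Q by auto
  then have "P * Q = 1\<^sub>m (dim_row B)" "Q * P = 1\<^sub>m (dim_row A)"
    using PQ by (simp_all only: inverts_mat_def)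
  from that[OF P Q this e] show thesis .
qed

lemma isometric_refl: "A \<in> carrier_mat n n \<Longrightarrow> isometric A A"
  by (rule isometricI[of "1\<^sub>m n" n n "1\<^sub>m n"]) simp_all

lemma isometric_sym:
  assumes "isometric A B" and B: "B \<in> carrier_mat m m"
  shows "isometric B A"
  using assms(1)
proof (rule isometricE)
  fix P Q
  assume P: "P \<in> carrier_mat (dim_row B) (dim_row A)" and Q: "Q \<in> carrier_mat (dim_row A) (dim_row B)"
    and PQ: "P * Q = 1\<^sub>m (dim_row B)" and QP: "Q * P = 1\<^sub>m (dim_row A)"
    and A: "A = transpose_mat P * B * P"
  have m: "dim_row B = m" using B by auto
  define n where "n = dim_row A"
  have c: "P \<in> carrier_mat m n" "Q \<in> carrier_mat n m" "transpose_mat P \<in> carrier_mat n m"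
    "transpose_mat Q \<in> carrier_mat m n" "B * P \<in> carrier_mat m n" "P * Q \<in> carrier_mat m m"
    using P Q B m unfolding n_def by auto
  have "A = transpose_mat P * (B * P)"
    unfolding A by (rule assoc_mult_mat[OF c(3) B c(1)])
  then have "transpose_mat Q * A * Q = (transpose_mat Q * transpose_mat P) * (B * P) * Q"
    by (simp only: assoc_mult_mat[OF c(4,3,5)])
  also have "\<dots> = (transpose_mat Q * transpose_mat P) * ((B * P) * Q)"
    by (rule assoc_mult_mat[OF mult_carrier_mat[OF c(4,3)] c(5,2)])
  also have "(B * P) * Q = B * (P * Q)" by (rule assoc_mult_mat[OF B c(1,2)])
  also have "\<dots> = B" unfolding PQ m by (rule right_mult_one_mat[OF B])
  also have "transpose_mat Q * transpose_mat P = transpose_mat (P * Q)"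
    by (rule transpose_mult[OF c(1,2), symmetric])
  also have "\<dots> * B = B" unfolding PQ m transpose_one by (rule left_mult_one_mat[OF B])
  finally have e: "B = transpose_mat Q * A * Q" ..
  show ?thesis
    by (rule isometricI[OF Q P QP PQ refl refl e])
qed

lemma isometric_trans:
  assumes "isometric A B" "isometric B C" and C: "C \<in> carrier_mat k k"
  shows "isometric A C"
proof -
  define n m where "n = dim_row A" and "m = dim_row B"
  have k: "dim_row C = k" using C by auto
  from assms(1) obtain P Q where P: "P \<in> carrier_mat m n" and Q: "Q \<in> carrier_mat n m"
    and 1: "P * Q = 1\<^sub>m m" "Q * P = 1\<^sub>m n" "A = transpose_mat P * B * P"
    unfolding n_def m_def by (rule isometricE)
  from assms(2) obtain R S where R: "R \<in> carrier_mat k m" and S: "S \<in> carrier_mat m k"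
    and 2: "R * S = 1\<^sub>m k" "S * R = 1\<^sub>m m" "B = transpose_mat R * C * R"
    unfolding k[symmetric] m_def by (rule isometricE)
  have "(R * P) * (Q * S) = R * ((P * Q) * S)" 
    using P Q R S by (simp add: assoc_mult_mat[of R k m P n "Q * S" k] assoc_mult_mat[of P m n Q m S k])
  also have "\<dots> = 1\<^sub>m k" using 1 2 S by simp
  finally have i1: "(R * P) * (Q * S) = 1\<^sub>m k" .
  have "(Q * S) * (R * P) = Q * ((S * R) * P)"
    using P Q R S by (simp add: assoc_mult_mat[of Q n m S k "R * P" n] assoc_mult_mat[of S m k R m P n])
  also have "\<dots> = 1\<^sub>m n" using 1 2 P by simp
  finally have i2: "(Q * S) * (R * P) = 1\<^sub>m n" .
  have Rt: "transpose_mat R \<in> carrier_mat m k" and Pt: "transpose_mat P \<in> carrier_mat n m" using R P by auto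
  have "A = transpose_mat P * (transpose_mat R * C * R) * P" using 1 2 by simp
  also have "\<dots> = (transpose_mat P * transpose_mat R) * C * (R * P)"
  proof -
    have "transpose_mat P * (transpose_mat R * C * R) * P = transpose_mat P * ((transpose_mat R * C * R) * P)"
      by (rule assoc_mult_mat[OF Pt mult_carrier_mat[OF mult_carrier_mat[OF Rt C] R] P])
    also have "(transpose_mat R * C * R) * P = (transpose_mat R * C) * (R * P)"
      by (rule assoc_mult_mat[OF mult_carrier_mat[OF Rt C] R P])
    also have "\<dots> = transpose_mat R * (C * (R * P))"
      by (rule assoc_mult_mat[OF Rt C mult_carrier_mat[OF R P]])
    also have "transpose_mat P * (transpose_mat R * (C * (R * P))) = (transpose_mat P * transpose_mat R) * (C * (R * P))"
      by (rule assoc_mult_mat[OF Pt Rt mult_carrier_mat[OF C mult_carrier_mat[OF R P]], symmetric])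
    also have "\<dots> = (transpose_mat P * transpose_mat R) * C * (R * P)"
      by (rule assoc_mult_mat[OF mult_carrier_mat[OF Pt Rt] C mult_carrier_mat[OF R P], symmetric])
    finally show ?thesis .
  qed
  also have "transpose_mat P * transpose_mat R = transpose_mat (R * P)"
    using R P by (simp add: transpose_mult)
  finally have e: "A = transpose_mat (R * P) * C * (R * P)" .
  show ?thesis
    by (rule isometricI[OF _ _ i1 i2 n_def[symmetric] k e]) (rule mult_carrier_mat P Q R S)+
qed

lemma orth_sum_carrier [simp]:
  "A \<in> carrier_mat n n \<Longrightarrow> B \<in> carrier_mat m m \<Longrightarrow> orth_sum A B \<in> carrier_mat (n + m) (n + m)"
  unfolding orth_sum_def by auto

lemma orth_sum_dim [simp]:
  "dim_row (orth_sum A B) = dim_row A + dim_row B" "dim_col (orth_sum A B) = dim_col A + dim_col B"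
  unfolding orth_sum_def by auto

lemma orth_sum_assoc: "orth_sum A (orth_sum B C) = orth_sum (orth_sum A B) C"
  using assoc_four_block_mat[of A B C] unfolding orth_sum_def by simp

lemma orth_sum_mult:
  assumes "A \<in> carrier_mat n k" "B \<in> carrier_mat m l" "C \<in> carrier_mat k i" "D \<in> carrier_mat l j"
  shows "orth_sum A B * orth_sum C D = orth_sum (A * C) (B * D)"
proof -
  have d: "dim_row A = n" "dim_col A = k" "dim_row B = m" "dim_col B = l"
    "dim_row C = k" "dim_col C = i" "dim_row D = l" "dim_col D = j" using assms by auto
  show ?thesis
    unfolding orth_sum_def d
    by (subst mult_four_block_mat[of A n k _ l _ m B C i _ j _ D]) (use assms in auto)
qed

lemma orth_sum_transpose: "transpose_mat (orth_sum A B) = orth_sum (transpose_mat A) (transpose_mat B)"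
  unfolding orth_sum_def
  by (subst transpose_four_block_mat[of A "dim_row A" "dim_col A" _ "dim_col B" _ "dim_row B"]) auto

lemma orth_sum_one: "orth_sum (1\<^sub>m n) (1\<^sub>m m) = 1\<^sub>m (n + m)"
  unfolding orth_sum_def by simp

lemma quadratic_orth_sum:
  assumes "quadratic_mat A" "quadratic_mat B"
  shows "quadratic_mat (orth_sum A B)"
proof -
  from assms(1) obtain n P where 1: "A \<in> carrier_mat n n" "P \<in> carrier_mat n n" "A * P = 1\<^sub>m n" "P * A = 1\<^sub>m n"
    "transpose_mat A = A" by (rule quadratic_matE)
  from assms(2) obtain m Q where 2: "B \<in> carrier_mat m m" "Q \<in> carrier_mat m m" "B * Q = 1\<^sub>m m" "Q * B = 1\<^sub>m m"
    "transpose_mat B = B" by (rule quadratic_matE)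
  from 1 2 show ?thesis
    by (intro quadratic_matI[of _ "n + m" "orth_sum P Q"])
      (auto simp: orth_sum_mult[of _ n n _ m m _ n _ m] orth_sum_transpose orth_sum_one)
qed

lemma isometric_orth_sum:
  assumes "isometric A A'" "isometric B B'" and A': "A' \<in> carrier_mat n n" and B': "B' \<in> carrier_mat m m"
  shows "isometric (orth_sum A B) (orth_sum A' B')"
proof -
  have d: "dim_row A' = n" "dim_row B' = m" using A' B' by auto
  define k l where "k = dim_row A" and "l = dim_row B"
  from assms(1) obtain P Q where 1: "P \<in> carrier_mat n k" "Q \<in> carrier_mat k n" "P * Q = 1\<^sub>m n" "Q * P = 1\<^sub>m k"
    "A = transpose_mat P * A' * P" unfolding d(1)[symmetric] k_def by (rule isometricE)
  from assms(2) obtain R S where 2: "R \<in> carrier_mat m l" "S \<in> carrier_mat l m" "R * S = 1\<^sub>m m" "S * R = 1\<^sub>m l"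
    "B = transpose_mat R * B' * R" unfolding d(2)[symmetric] l_def by (rule isometricE)
  have c: "transpose_mat P \<in> carrier_mat k n" "transpose_mat R \<in> carrier_mat l m" using 1 2 by auto
  have dP: "dim_row P = n" "dim_row R = m" "dim_col P = k" "dim_col R = l"
    "dim_row Q = k" "dim_row S = l" "dim_col Q = n" "dim_col S = m" using 1 2 by auto
  have i1: "orth_sum P R * orth_sum Q S = 1\<^sub>m (n + m)"
    by (subst orth_sum_mult[OF 1(1) 2(1) 1(2) 2(2)]) (simp add: 1(3) 2(3) orth_sum_one)
  have i2: "orth_sum Q S * orth_sum P R = 1\<^sub>m (k + l)"
    by (subst orth_sum_mult[OF 1(2) 2(2) 1(1) 2(1)]) (simp add: 1(4) 2(4) orth_sum_one)
  have e: "orth_sum A B = transpose_mat (orth_sum P R) * orth_sum A' B' * orth_sum P R"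
    unfolding orth_sum_transpose
    by (subst orth_sum_mult[OF c A' B'], subst orth_sum_mult[of _ k n _ l m])
      (use c A' B' 1 2 in auto)
  show ?thesis
    by (rule isometricI[OF _ _ i1 i2 _ _ e]) (auto simp: dP d k_def l_def)
qed

lemma isometric_orth_sum_commute:
  assumes A: "A \<in> carrier_mat n n" and B: "B \<in> carrier_mat m m"
  shows "isometric (orth_sum A B) (orth_sum B A)"
proof -
  have d: "dim_row A = n" "dim_row B = m" "dim_col A = n" "dim_col B = m" using A B by auto
  let ?P = "\<lambda>m n. four_block_mat (0\<^sub>m m n) (1\<^sub>m m) (1\<^sub>m n) (0\<^sub>m n m) :: 'a mat"
  have c: "?P m n \<in> carrier_mat (m + n) (n + m)" for m n by auto
  have PP: "?P m n * ?P n m = 1\<^sub>m (m + n)" for m n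
    by (subst mult_four_block_mat[of _ m n _ m _ n]) auto
  have t: "transpose_mat (?P m n) = ?P n m"
    by (subst transpose_four_block_mat[of _ m n _ m _ n]) (auto simp: )
  have z: "0\<^sub>m n m * B = 0\<^sub>m n m" "A * 0\<^sub>m n m = 0\<^sub>m n m" "B * 0\<^sub>m m n = 0\<^sub>m m n" "0\<^sub>m m n * A = 0\<^sub>m m n"
    "1\<^sub>m n * A = A" "1\<^sub>m m * B = B" "A * 1\<^sub>m n = A" "B * 1\<^sub>m m = B"
    using A B by auto
  have 1: "?P n m * orth_sum B A = four_block_mat (0\<^sub>m n m) A B (0\<^sub>m m n)"
    unfolding orth_sum_def d
    by (subst mult_four_block_mat[of _ n m _ n _ m _ _ m _ n])
      (use A B in \<open>auto simp: z\<close>)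
  have 2: "four_block_mat (0\<^sub>m n m) A B (0\<^sub>m m n) * ?P m n = orth_sum A B"
    unfolding orth_sum_def d
    by (subst mult_four_block_mat[of _ n m _ n _ m _ _ n _ m])
      (use A B in \<open>auto simp: z\<close>)
  have e: "orth_sum A B = transpose_mat (?P m n) * orth_sum B A * ?P m n"
    unfolding t 1 2 ..
  have c': "?P n m \<in> carrier_mat (n + m) (m + n)" by (rule c)
  show ?thesis
    by (rule isometricI[OF c c' PP PP _ _ e]) (simp_all add: d)
qed

lemma orth_sum_form:
  assumes "A \<in> carrier_mat n n" "B \<in> carrier_mat m m"
    and "a \<in> carrier_vec n" "c \<in> carrier_vec n" "b \<in> carrier_vec m" "d \<in> carrier_vec m"
  shows "(a @\<^sub>v b) \<bullet> (orth_sum A B *\<^sub>v (c @\<^sub>v d)) = a \<bullet> (A *\<^sub>v c) + b \<bullet> (B *\<^sub>v d)"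
proof -
  have [simp]: "dim_row A = n" "dim_row B = m" "dim_col A = n" "dim_col B = m"
    using assms by auto
  have Ac: "A *\<^sub>v c \<in> carrier_vec n" and Bd: "B *\<^sub>v d \<in> carrier_vec m"
    using assms by auto
  have z: "0\<^sub>m n m *\<^sub>v d = 0\<^sub>v n" "0\<^sub>m m n *\<^sub>v c = 0\<^sub>v m"
    using assms(4,6) by (auto intro!: eq_vecI)
  have "orth_sum A B *\<^sub>v (c @\<^sub>v d) = (A *\<^sub>v c + 0\<^sub>m n m *\<^sub>v d) @\<^sub>v (0\<^sub>m m n *\<^sub>v c + B *\<^sub>v d)"
    unfolding orth_sum_def
    by (simp, rule four_block_mat_mult_vec[OF assms(1) _ _ assms(2,4,6)]) simp_all
  also have "\<dots> = (A *\<^sub>v c) @\<^sub>v (B *\<^sub>v d)"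
    unfolding z using Ac Bd by simp
  finally have e: "orth_sum A B *\<^sub>v (c @\<^sub>v d) = (A *\<^sub>v c) @\<^sub>v (B *\<^sub>v d)" .
  show ?thesis unfolding e
    by (rule scalar_prod_append[OF assms(3,5) Ac Bd])
qed

lemma metabolicI:
  assumes "quadratic_mat A" "A \<in> carrier_mat n n"
    and "L = {v \<in> carrier_vec n. \<forall>w\<in>L. v \<bullet> (A *\<^sub>v w) = 0}"
  shows "metabolic A"
proof -
  have d: "dim_row A = n" using assms(2) by auto
  have "\<exists>L. L = {v \<in> carrier_vec (dim_row A). \<forall>w\<in>L. v \<bullet> (A *\<^sub>v w) = 0}"
    unfolding d by (rule exI[of _ L]) (rule assms(3))
  then show ?thesis unfolding metabolic_def by (rule conjI[OF assms(1)])
qed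

lemma metabolic_orth_sum:
  assumes "metabolic A" "metabolic B"
  shows "metabolic (orth_sum A B)"
proof -
  define n m where "n = dim_row A" and "m = dim_row B"
  from assms(1) obtain K where qA: "quadratic_mat A" and K: "K = {v \<in> carrier_vec n. \<forall>w\<in>K. v \<bullet> (A *\<^sub>v w) = 0}"
    unfolding metabolic_def n_def by blast
  from assms(2) obtain L where qB: "quadratic_mat B" and L: "L = {v \<in> carrier_vec m. \<forall>w\<in>L. v \<bullet> (B *\<^sub>v w) = 0}"
    unfolding metabolic_def m_def by blast
  have A: "A \<in> carrier_mat n n" and B: "B \<in> carrier_mat m m"
    using qA qB quadratic_mat_carrier unfolding n_def m_def by auto
  have Kc: "K \<subseteq> carrier_vec n" and Lc: "L \<subseteq> carrier_vec m" using K L by blast+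
  have zK: "0\<^sub>v n \<in> K" by (subst K) (use Kc A in \<open>auto intro!: scalar_prod_left_zero\<close>)
  have zL: "0\<^sub>v m \<in> L" by (subst L) (use Lc B in \<open>auto intro!: scalar_prod_left_zero\<close>)
  define M where "M = {a @\<^sub>v b | a b. a \<in> K \<and> b \<in> L}"
  have "M = {v \<in> carrier_vec (n + m). \<forall>w\<in>M. v \<bullet> (orth_sum A B *\<^sub>v w) = 0}"
  proof (intro equalityI subsetI CollectI conjI ballI)
    fix v assume "v \<in> M"
    then obtain a b where v: "v = a @\<^sub>v b" and ab: "a \<in> K" "b \<in> L" unfolding M_def by blast
    with Kc Lc show "v \<in> carrier_vec (n + m)" by auto
    fix w assume "w \<in> M"
    then obtain c d where w: "w = c @\<^sub>v d" and cd: "c \<in> K" "d \<in> L" unfolding M_def by blast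
    have "a \<bullet> (A *\<^sub>v c) = 0" "b \<bullet> (B *\<^sub>v d) = 0"
      using ab cd K L by blast+
    then show "v \<bullet> (orth_sum A B *\<^sub>v w) = 0"
      unfolding v w by (subst orth_sum_form[OF A B]) (use ab cd Kc Lc in auto)
  next
    fix v assume v: "v \<in> {v \<in> carrier_vec (n + m). \<forall>w\<in>M. v \<bullet> (orth_sum A B *\<^sub>v w) = 0}"
    define a b where "a = vec_first v n" and "b = vec_last v m"
    have vab: "v = a @\<^sub>v b" using v unfolding a_def b_def by simp
    have a: "a \<in> carrier_vec n" and b: "b \<in> carrier_vec m" unfolding a_def b_def by auto
    have orth: "a \<bullet> (A *\<^sub>v c) + b \<bullet> (B *\<^sub>v d) = 0" if "c \<in> K" "d \<in> L" for c d
    proof -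
      have "c @\<^sub>v d \<in> M" using that unfolding M_def by blast
      then have "v \<bullet> (orth_sum A B *\<^sub>v (c @\<^sub>v d)) = 0" using v by blast
      moreover have "v \<bullet> (orth_sum A B *\<^sub>v (c @\<^sub>v d)) = a \<bullet> (A *\<^sub>v c) + b \<bullet> (B *\<^sub>v d)"
        unfolding vab by (rule orth_sum_form[OF A B a _ b]) (use that Kc Lc in auto)
      ultimately show ?thesis by simp
    qed
    have "B *\<^sub>v 0\<^sub>v m = 0\<^sub>v m" "A *\<^sub>v 0\<^sub>v n = 0\<^sub>v n" using A B by auto
    then have z: "a \<bullet> (A *\<^sub>v 0\<^sub>v n) = 0" "b \<bullet> (B *\<^sub>v 0\<^sub>v m) = 0" using a b by auto
    have "a \<in> K" by (subst K) (use a orth[OF _ zL] z in auto)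
    moreover have "b \<in> L" by (subst L) (use b orth[OF zK] z in auto)
    ultimately show "v \<in> M" unfolding M_def vab by blast
  qed
  then show ?thesis
    by (rule metabolicI[OF quadratic_orth_sum[OF qA qB] orth_sum_carrier[OF A B]])
qed

definition zero_form :: "'a::field mat" where
  "zero_form = 0\<^sub>m 0 0"

lemma quadratic_zero_form: "quadratic_mat zero_form"
  unfolding zero_form_def by (rule quadratic_matI[of _ 0 "0\<^sub>m 0 0"]) auto

lemma metabolic_zero_form: "metabolic (zero_form :: 'a::field mat)"
proof -
  let ?L = "carrier_vec 0 :: 'a vec set"
  have "?L = {v \<in> carrier_vec 0. \<forall>w\<in>?L. v \<bullet> (zero_form *\<^sub>v w) = 0}"
    by (auto simp: scalar_prod_def zero_form_def)
  then show ?thesis by (rule metabolicI[OF quadratic_zero_form, rotated]) (simp add: zero_form_def)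
qed

lemma orth_sum_zero_form [simp]: "orth_sum zero_form A = A" "orth_sum A zero_form = A"
  unfolding orth_sum_def zero_form_def by (intro eq_matI) auto

lemma witt_equivI:
  assumes "quadratic_mat A" "quadratic_mat B" "isometric A B"
  shows "witt_equiv A B"
  unfolding witt_equiv_def
  using assms by (intro conjI exI[of _ zero_form]) (auto simp: metabolic_zero_form)

lemma witt_equiv_refl: "quadratic_mat A \<Longrightarrow> witt_equiv A A"
  by (intro witt_equivI isometric_refl[OF quadratic_mat_carrier])

lemma witt_equiv_sym:
  assumes "witt_equiv A B"
  shows "witt_equiv B A"
proof -
  from assms obtain M N where *: "quadratic_mat A" "quadratic_mat B" "metabolic M" "metabolic N"
    "isometric (orth_sum A M) (orth_sum B N)"
    unfolding witt_equiv_def by blast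
  have "quadratic_mat (orth_sum B N)" using * by (intro quadratic_orth_sum) (auto simp: metabolic_def)
  then have "isometric (orth_sum B N) (orth_sum A M)"
    by (intro isometric_sym[OF *(5) quadratic_mat_carrier])
  with * show ?thesis unfolding witt_equiv_def by blast
qed

lemma isometric_swap_right:
  assumes "A \<in> carrier_mat n n" "B \<in> carrier_mat m m" "C \<in> carrier_mat k k"
  shows "isometric (orth_sum (orth_sum A B) C) (orth_sum (orth_sum A C) B)"
  unfolding orth_sum_assoc[symmetric]
  by (rule isometric_orth_sum[OF isometric_refl isometric_orth_sum_commute]) (use assms in auto)

lemma witt_equiv_trans:
  assumes "witt_equiv A B" "witt_equiv B C"
  shows "witt_equiv A C"
proof -
  from assms(1) obtain M N where 1: "quadratic_mat A" "quadratic_mat B" "metabolic M" "metabolic N"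
    "isometric (orth_sum A M) (orth_sum B N)"
    unfolding witt_equiv_def by blast
  from assms(2) obtain M' N' where 2: "quadratic_mat C" "metabolic M'" "metabolic N'"
    "isometric (orth_sum B M') (orth_sum C N')"
    unfolding witt_equiv_def by blast
  note q = quadratic_mat_carrier
  have c: "A \<in> carrier_mat (dim_row A) (dim_row A)" "B \<in> carrier_mat (dim_row B) (dim_row B)"
    "C \<in> carrier_mat (dim_row C) (dim_row C)" "M \<in> carrier_mat (dim_row M) (dim_row M)"
    "N \<in> carrier_mat (dim_row N) (dim_row N)" "M' \<in> carrier_mat (dim_row M') (dim_row M')"
    "N' \<in> carrier_mat (dim_row N') (dim_row N')"
    using 1 2 by (auto intro!: q simp: metabolic_def)
  have i: "isometric (orth_sum (orth_sum A M) M') (orth_sum (orth_sum B N) M')"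
    by (rule isometric_orth_sum[OF 1(5) isometric_refl[OF c(6)] orth_sum_carrier c(6)]) (rule c)+
  have ii: "isometric (orth_sum (orth_sum B N) M') (orth_sum (orth_sum B M') N)"
    by (rule isometric_swap_right) (rule c)+
  have iii: "isometric (orth_sum (orth_sum B M') N) (orth_sum (orth_sum C N') N)"
    by (rule isometric_orth_sum[OF 2(4) isometric_refl[OF c(5)] orth_sum_carrier c(5)]) (rule c)+
  have "isometric (orth_sum (orth_sum B N) M') (orth_sum (orth_sum C N') N)"
    by (rule isometric_trans[OF ii iii orth_sum_carrier[OF orth_sum_carrier]]) (rule c)+
  then have "isometric (orth_sum (orth_sum A M) M') (orth_sum (orth_sum C N') N)"
    by (rule isometric_trans[OF i _ orth_sum_carrier[OF orth_sum_carrier]]) (rule c)+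
  then show ?thesis
    using 1 2 metabolic_orth_sum unfolding witt_equiv_def orth_sum_assoc[symmetric] by blast
qed

lemma witt_equiv_commute:
  assumes "quadratic_mat A" "quadratic_mat B"
  shows "witt_equiv (orth_sum A B) (orth_sum B A)"
  by (rule witt_equivI[OF quadratic_orth_sum[OF assms] quadratic_orth_sum[OF assms(2,1)]
        isometric_orth_sum_commute[OF assms[THEN quadratic_mat_carrier]]])

lemma witt_equiv_orth_sum:
  assumes "witt_equiv A A'" "witt_equiv B B'"
  shows "witt_equiv (orth_sum A B) (orth_sum A' B')"
proof -
  have shift: "witt_equiv (orth_sum A B) (orth_sum A' B)" if "witt_equiv A A'" "quadratic_mat B"
    for A A' B :: "'a mat"
  proof -
    from that(1) obtain M N where 1: "quadratic_mat A" "quadratic_mat A'" "metabolic M" "metabolic N"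
      "isometric (orth_sum A M) (orth_sum A' N)"
      unfolding witt_equiv_def by blast
    have c: "A \<in> carrier_mat (dim_row A) (dim_row A)" "A' \<in> carrier_mat (dim_row A') (dim_row A')"
      "B \<in> carrier_mat (dim_row B) (dim_row B)" "M \<in> carrier_mat (dim_row M) (dim_row M)"
      "N \<in> carrier_mat (dim_row N) (dim_row N)"
      using 1 that by (auto intro!: quadratic_mat_carrier simp: metabolic_def)
    have i: "isometric (orth_sum (orth_sum A B) M) (orth_sum (orth_sum A M) B)"
      by (rule isometric_swap_right) (rule c)+
    have ii: "isometric (orth_sum (orth_sum A M) B) (orth_sum (orth_sum A' N) B)"
      by (rule isometric_orth_sum[OF 1(5) isometric_refl[OF c(3)] orth_sum_carrier c(3)]) (rule c)+
    have iii: "isometric (orth_sum (orth_sum A' N) B) (orth_sum (orth_sum A' B) N)"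
      by (rule isometric_swap_right) (rule c)+
    have "isometric (orth_sum (orth_sum A M) B) (orth_sum (orth_sum A' B) N)"
      by (rule isometric_trans[OF ii iii orth_sum_carrier[OF orth_sum_carrier]]) (rule c)+
    then have "isometric (orth_sum (orth_sum A B) M) (orth_sum (orth_sum A' B) N)"
      by (rule isometric_trans[OF i _ orth_sum_carrier[OF orth_sum_carrier]]) (rule c)+
    then show ?thesis
      using 1 that quadratic_orth_sum unfolding witt_equiv_def by blast
  qed
  have q: "quadratic_mat A" "quadratic_mat A'" "quadratic_mat B" "quadratic_mat B'"
    using assms by (auto simp: witt_equiv_def)
  have "witt_equiv (orth_sum A B) (orth_sum A' B)" using shift assms q by blast
  moreover have "witt_equiv (orth_sum A' B) (orth_sum B A')" using witt_equiv_commute q by blast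
  moreover have "witt_equiv (orth_sum B A') (orth_sum B' A')" using shift assms q by blast
  moreover have "witt_equiv (orth_sum B' A') (orth_sum A' B')" using witt_equiv_commute q by blast
  ultimately show ?thesis by (blast intro: witt_equiv_trans)
qed

lemma quadratic_uminus:
  assumes "quadratic_mat A"
  shows "quadratic_mat (- A)"
  using assms
proof (rule quadratic_matE)
  fix n Q
  assume *: "A \<in> carrier_mat n n" "Q \<in> carrier_mat n n" "A * Q = 1\<^sub>m n" "Q * A = 1\<^sub>m n"
    "transpose_mat A = A"
  have "transpose_mat (- A) = - transpose_mat A" by (intro eq_matI) auto
  with * show ?thesis
    by (intro quadratic_matI[of _ n "- Q"]) auto
qed

lemma metabolic_diff:
  assumes "quadratic_mat A"
  shows "metabolic (orth_sum A (- A))"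
  using assms
proof (rule quadratic_matE)
  fix n Q
  assume A: "A \<in> carrier_mat n n" and Q: "Q \<in> carrier_mat n n" and AQ: "A * Q = 1\<^sub>m n"
  have A': "- A \<in> carrier_mat n n" using A by simp
  define L where "L = {a @\<^sub>v a | a :: 'a vec. a \<in> carrier_vec n}"
  have neg: "b \<bullet> ((- A) *\<^sub>v c) = - (b \<bullet> (A *\<^sub>v c))"
    if "b \<in> carrier_vec n" "c \<in> carrier_vec n" for b c
  proof -
    have "(- A) *\<^sub>v c = - (A *\<^sub>v c)" using A that by (intro eq_vecI) auto
    then show ?thesis using A that by simp
  qed
  have "L = {v \<in> carrier_vec (n + n). \<forall>w\<in>L. v \<bullet> (orth_sum A (- A) *\<^sub>v w) = 0}"
  proof (intro equalityI subsetI CollectI conjI ballI)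
    fix v assume "v \<in> L"
    then obtain a where v: "v = a @\<^sub>v a" and a: "a \<in> carrier_vec n" unfolding L_def by blast
    then show "v \<in> carrier_vec (n + n)" by auto
    fix w assume "w \<in> L"
    then obtain c where w: "w = c @\<^sub>v c" and c: "c \<in> carrier_vec n" unfolding L_def by blast
    show "v \<bullet> (orth_sum A (- A) *\<^sub>v w) = 0"
      unfolding v w by (subst orth_sum_form[OF A A']) (use a c neg in auto)
  next
    fix v assume v: "v \<in> {v \<in> carrier_vec (n + n). \<forall>w\<in>L. v \<bullet> (orth_sum A (- A) *\<^sub>v w) = 0}"
    define a b where "a = vec_first v n" and "b = vec_last v n"
    have vab: "v = a @\<^sub>v b" using v unfolding a_def b_def by simp
    have a: "a \<in> carrier_vec n" and b: "b \<in> carrier_vec n" unfolding a_def b_def by auto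
    have eq: "a \<bullet> y = b \<bullet> y" if y: "y \<in> carrier_vec n" for y
    proof -
      define c where "c = Q *\<^sub>v y"
      have c: "c \<in> carrier_vec n" using Q y unfolding c_def by auto
      have Ac: "A *\<^sub>v c = y"
        using A Q y AQ unfolding c_def by (simp add: assoc_mult_mat_vec[symmetric])
      have "c @\<^sub>v c \<in> L" using c unfolding L_def by blast
      then have "v \<bullet> (orth_sum A (- A) *\<^sub>v (c @\<^sub>v c)) = 0" using v by blast
      moreover have "v \<bullet> (orth_sum A (- A) *\<^sub>v (c @\<^sub>v c)) = a \<bullet> y - b \<bullet> y"
        unfolding vab by (subst orth_sum_form[OF A A' a c b c]) (simp add: neg[OF b c] Ac)
      ultimately show ?thesis by simp
    qed
    have "a $ i = b $ i" if "i < n" for i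
      using eq[of "unit_vec n i"] that a b by simp
    then have "a = b" using a b by (intro eq_vecI) auto
    then show "v \<in> L" using a unfolding L_def vab by blast
  qed
  then show ?thesis
    by (rule metabolicI[OF quadratic_orth_sum[OF assms quadratic_uminus[OF assms]]
          orth_sum_carrier[OF A A']])
qed

lemma witt_equiv_metabolic: "metabolic M \<Longrightarrow> witt_equiv M zero_form"
proof -
  assume M: "metabolic M"
  then have "isometric (orth_sum M zero_form) (orth_sum zero_form M)"
    by (auto intro: isometric_refl quadratic_mat_carrier simp: metabolic_def)
  with M show ?thesis
    unfolding witt_equiv_def using metabolic_zero_form quadratic_zero_form
    by (metis metabolic_def)
qed

lemma quadratic_if_witt_equiv: "witt_equiv A B \<Longrightarrow> quadratic_mat A" "witt_equiv A B \<Longrightarrow> quadratic_mat B"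
  by (auto simp: witt_equiv_def)

lemma witt_equiv_uminus:
  assumes AB: "witt_equiv A B"
  shows "witt_equiv (- A) (- B)"
proof -
  have q: "quadratic_mat A" "quadratic_mat B" "quadratic_mat (- A)" "quadratic_mat (- B)"
    using AB by (auto simp: witt_equiv_def quadratic_uminus)
  have "witt_equiv (- A) (orth_sum (- A) (orth_sum B (- B)))"
    using witt_equiv_orth_sum[OF witt_equiv_refl[OF q(3)]
        witt_equiv_sym[OF witt_equiv_metabolic[OF metabolic_diff[OF q(2)]]]] by simp
  also have "\<dots> = orth_sum (orth_sum (- A) B) (- B)" by (rule orth_sum_assoc)
  finally have 1: "witt_equiv (- A) (orth_sum (orth_sum (- A) B) (- B))" .
  have "witt_equiv (orth_sum (- A) B) (orth_sum (- A) A)"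
    by (rule witt_equiv_orth_sum[OF witt_equiv_refl[OF q(3)] witt_equiv_sym[OF AB]])
  moreover have "witt_equiv (orth_sum (- A) A) (orth_sum A (- A))"
    by (intro witt_equiv_commute q)
  moreover have "witt_equiv (orth_sum A (- A)) zero_form"
    by (intro witt_equiv_metabolic metabolic_diff q)
  ultimately have "witt_equiv (orth_sum (- A) B) zero_form" by (blast intro: witt_equiv_trans)
  from witt_equiv_orth_sum[OF this witt_equiv_refl[OF q(4)]]
  have "witt_equiv (orth_sum (orth_sum (- A) B) (- B)) (- B)" by simp
  with 1 show ?thesis by (rule witt_equiv_trans)
qed

quotient_type (overloaded) 'a witt = "'a::field mat" / partial: witt_equiv
proof (rule part_equivpI)
  show "\<exists>A :: 'a mat. witt_equiv A A" using witt_equiv_refl quadratic_zero_form by blast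
  show "symp (witt_equiv :: 'a mat \<Rightarrow> _)" by (rule sympI) (rule witt_equiv_sym)
  show "transp (witt_equiv :: 'a mat \<Rightarrow> _)" by (rule transpI) (rule witt_equiv_trans)
qed

instantiation witt :: (field) ab_group_add
begin

lift_definition zero_witt :: "'a witt" is zero_form
  by (rule witt_equiv_refl[OF quadratic_zero_form])

lift_definition plus_witt :: "'a witt \<Rightarrow> 'a witt \<Rightarrow> 'a witt" is orth_sum
  by (rule witt_equiv_orth_sum)

lift_definition uminus_witt :: "'a witt \<Rightarrow> 'a witt" is uminus
  by (rule witt_equiv_uminus)

definition minus_witt :: "'a witt \<Rightarrow> 'a witt \<Rightarrow> 'a witt" where
  "minus_witt a b = a + (- b)"

instance
proof
  fix a b c :: "'a witt"
  show "a + b + c = a + (b + c)"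
    by transfer (simp add: orth_sum_assoc witt_equiv_refl quadratic_orth_sum quadratic_if_witt_equiv(1))
  show "a + b = b + a"
    by transfer (intro witt_equiv_commute quadratic_if_witt_equiv(1))
  show "0 + a = a"
    by transfer simp
  show "- a + a = 0"
  proof transfer
    fix A :: "'a mat" assume "witt_equiv A A"
    then have q: "quadratic_mat A" by (simp add: witt_equiv_def)
    have "witt_equiv (orth_sum (- A) A) (orth_sum A (- A))"
      by (intro witt_equiv_commute quadratic_uminus q)
    moreover have "witt_equiv (orth_sum A (- A)) zero_form"
      by (intro witt_equiv_metabolic metabolic_diff q)
    ultimately show "witt_equiv (orth_sum (- A) A) zero_form" by (rule witt_equiv_trans)
  qed
  show "a - b = a + - b" by (rule minus_witt_def)
qed

end

text \<open>
  A possibly degenerate symmetric bilinear form \<open>q\<close> on a subspace \<open>U\<close> represents the class of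
  \<open>U / rad q\<close>.  An isometry of \<open>U / rad q\<close> with \<open>F\<^sup>n\<close>, carrying the form given by \<open>A\<close>, is here a
  linear surjection \<open>\<phi>\<close> from \<open>U\<close> to \<open>F\<^sup>n\<close> that has kernel \<open>rad q\<close> and pulls the form back to \<open>q\<close>.
\<close>

definition form_radical :: "'v set \<Rightarrow> ('v \<Rightarrow> 'v \<Rightarrow> 'a::zero) \<Rightarrow> 'v set" where
  "form_radical U q = {u \<in> U. \<forall>v\<in>U. q u v = 0}"

definition quotient_isometry ::
  "('a::field \<Rightarrow> 'v \<Rightarrow> 'v::ab_group_add) \<Rightarrow> 'v set \<Rightarrow> ('v \<Rightarrow> 'v \<Rightarrow> 'a) \<Rightarrow> 'a mat \<Rightarrow> ('v \<Rightarrow> 'a vec) \<Rightarrow> bool"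
where
  "quotient_isometry scale U q A \<phi> \<longleftrightarrow>
     \<phi> ` U = carrier_vec (dim_row A) \<and>
     (\<forall>u\<in>U. \<forall>v\<in>U. \<phi> (u + v) = \<phi> u + \<phi> v) \<and>
     (\<forall>c. \<forall>u\<in>U. \<phi> (scale c u) = c \<cdot>\<^sub>v \<phi> u) \<and>
     {u \<in> U. \<phi> u = 0\<^sub>v (dim_row A)} = form_radical U q \<and>
     (\<forall>u\<in>U. \<forall>v\<in>U. q u v = \<phi> u \<bullet> (A *\<^sub>v \<phi> v))"

definition witt_class ::
  "('a::field \<Rightarrow> 'v \<Rightarrow> 'v::ab_group_add) \<Rightarrow> 'v set \<Rightarrow> ('v \<Rightarrow> 'v \<Rightarrow> 'a) \<Rightarrow> 'a witt"
where
  "witt_class scale U q =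
     (THE x. \<exists>A \<phi>. quadratic_mat A \<and> quotient_isometry scale U q A \<phi> \<and> x = abs_witt A)"


text \<open>The class does not depend on the choice of \<open>A\<close> and \<open>\<phi>\<close>.\<close>

lemma quotient_isometry_sum:
  fixes k :: nat
  assumes vs: "vector_space scale" and U: "module.subspace scale U"
    and q: "quotient_isometry scale U q A \<phi>" and A: "A \<in> carrier_mat n n"
    and u: "\<And>i. i < k \<Longrightarrow> u i \<in> U"
  shows "(\<Sum>i<k. scale (c i) (u i)) \<in> U \<and>
    \<phi> (\<Sum>i<k. scale (c i) (u i)) = vec n (\<lambda>j. \<Sum>i<k. c i * \<phi> (u i) $ j)"
  using u
proof (induction k)
  case 0
  interpret vector_space scale by (rule vs)
  have d: "dim_row A = n" using A by auto
  have z: "0 \<in> U" by (rule subspace_0[OF U])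
  have "\<forall>v\<in>U. q 0 v = 0"
  proof
    fix v assume v: "v \<in> U"
    have "\<phi> (scale 0 0) = 0 \<cdot>\<^sub>v \<phi> 0" using q z unfolding quotient_isometry_def by blast
    moreover have c: "\<phi> 0 \<in> carrier_vec n" "\<phi> v \<in> carrier_vec n"
      using q z v d unfolding quotient_isometry_def by auto
    moreover have "0 \<cdot>\<^sub>v \<phi> 0 = 0\<^sub>v n" using c(1) by (intro eq_vecI) auto
    ultimately have "\<phi> 0 = 0\<^sub>v n" by simp
    moreover have "q 0 v = \<phi> 0 \<bullet> (A *\<^sub>v \<phi> v)" using q z v unfolding quotient_isometry_def by blast
    ultimately show "q 0 v = 0" using c A by simp
  qed
  then have "0 \<in> form_radical U q" using z unfolding form_radical_def by blast
  then have "\<phi> 0 = 0\<^sub>v n" using q d unfolding quotient_isometry_def by blast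
  then show ?case using z by (auto simp: zero_vec_def)
next
  case (Suc k)
  interpret vector_space scale by (rule vs)
  let ?s = "\<Sum>i<k. scale (c i) (u i)"
  have IH: "?s \<in> U" "\<phi> ?s = vec n (\<lambda>j. \<Sum>i<k. c i * \<phi> (u i) $ j)" using Suc by auto
  have uk: "u k \<in> U" "scale (c k) (u k) \<in> U" using Suc.prems subspace_scale[OF U] by auto
  have d: "dim_row A = n" using A by auto
  have "\<phi> (u k) \<in> carrier_vec n" using q uk d unfolding quotient_isometry_def by auto
  moreover have "\<phi> (?s + scale (c k) (u k)) = \<phi> ?s + c k \<cdot>\<^sub>v \<phi> (u k)"
    using q uk IH(1) unfolding quotient_isometry_def by metis
  ultimately show ?case
    using subspace_add[OF U IH(1) uk(2)] by (auto simp: IH(2))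
qed

lemma quotient_isometry_matrix:
  assumes vs: "vector_space scale" and U: "module.subspace scale U"
    and A: "A \<in> carrier_mat n n" and A': "A' \<in> carrier_mat m m"
    and q: "quotient_isometry scale U q A \<phi>" and q': "quotient_isometry scale U q A' \<psi>"
  shows "\<exists>P\<in>carrier_mat m n. \<forall>x\<in>U. \<psi> x = P *\<^sub>v \<phi> x"
proof -
  interpret vector_space scale by (rule vs)
  have d: "dim_row A = n" "dim_row A' = m" using A A' by auto
  have "\<exists>x\<in>U. \<phi> x = unit_vec n i" for i
  proof -
    have "unit_vec n i \<in> \<phi> ` U" using q d unfolding quotient_isometry_def by simp
    then show ?thesis by (auto simp: image_iff eq_commute)
  qed
  then obtain u where u: "\<And>i. u i \<in> U" "\<And>i. \<phi> (u i) = unit_vec n i" by metis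
  define P where "P = mat m n (\<lambda>(j, i). \<psi> (u i) $ j)"
  have "\<psi> x = P *\<^sub>v \<phi> x" if x: "x \<in> U" for x
  proof -
    define y where "y = (\<Sum>i<n. scale (\<phi> x $ i) (u i))"
    have px: "\<phi> x \<in> carrier_vec n" "\<psi> x \<in> carrier_vec m"
      using q q' x d unfolding quotient_isometry_def by auto
    have y: "y \<in> U" and py: "\<phi> y = vec n (\<lambda>j. \<Sum>i<n. \<phi> x $ i * \<phi> (u i) $ j)"
      unfolding y_def using quotient_isometry_sum[OF vs U q A, of n u] u(1) by blast+
    have py': "\<psi> y = vec m (\<lambda>j. \<Sum>i<n. \<phi> x $ i * \<psi> (u i) $ j)"
      unfolding y_def using quotient_isometry_sum[OF vs U q' A', of n u] u(1) by blast
    have e: "\<phi> y = \<phi> x"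
      unfolding py using px(1)
      by (intro eq_vecI) (auto simp: u(2) if_distrib[of "(*) _"] sum.delta cong: if_cong)
    define z where "z = x + scale (- 1) y"
    have z: "z \<in> U" unfolding z_def using x y subspace_add[OF U] subspace_scale[OF U] by blast
    have xz: "x = y + z" unfolding z_def by (simp add: algebra_simps)
    have "\<phi> z = \<phi> x + (- 1) \<cdot>\<^sub>v \<phi> y"
      unfolding z_def using q x y subspace_scale[OF U, of y "- 1"] unfolding quotient_isometry_def by metis
    also have "\<dots> = 0\<^sub>v n" unfolding e using px(1) by (intro eq_vecI) auto
    finally have "z \<in> form_radical U q" using z q d unfolding quotient_isometry_def by blast
    then have pz: "\<psi> z = 0\<^sub>v m" using q' d unfolding quotient_isometry_def by blast
    have "\<psi> x = \<psi> y + \<psi> z" using q' y z xz unfolding quotient_isometry_def by metis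
    also have "\<dots> = \<psi> y" unfolding pz py' by auto
    also have "\<dots> = P *\<^sub>v \<phi> x"
      unfolding py' P_def using px(1)
      by (intro eq_vecI) (auto simp: scalar_prod_def mult.commute atLeast0LessThan)
    finally show ?thesis .
  qed
  moreover have "P \<in> carrier_mat m n" unfolding P_def by simp
  ultimately show ?thesis by blast
qed

lemma mat_eq_by_form:
  assumes A: "A \<in> carrier_mat n k" and B: "B \<in> carrier_mat n k"
    and e: "\<And>v w. v \<in> carrier_vec n \<Longrightarrow> w \<in> carrier_vec k \<Longrightarrow> v \<bullet> (A *\<^sub>v w) = v \<bullet> (B *\<^sub>v w)"
  shows "A = (B :: 'a::comm_ring_1 mat)"
proof (rule eq_matI)
  fix i j assume "i < dim_row B" "j < dim_col B"
  then have ij: "i < n" "j < k" using B by auto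
  have f: "unit_vec n i \<bullet> (C *\<^sub>v unit_vec k j) = C $$ (i, j)" if C: "C \<in> carrier_mat n k"
    for C :: "'a mat"
  proof -
    have "C *\<^sub>v unit_vec k j \<in> carrier_vec n" using C by auto
    then have "unit_vec n i \<bullet> (C *\<^sub>v unit_vec k j) = (C *\<^sub>v unit_vec k j) $ i" using ij by simp
    also have "\<dots> = row C i \<bullet> unit_vec k j" using C ij by simp
    also have "\<dots> = row C i $ j" by (rule scalar_prod_right_unit[OF ij(2)])
    also have "\<dots> = C $$ (i, j)" using C ij by simp
    finally show ?thesis .
  qed
  show "A $$ (i, j) = B $$ (i, j)"
    using e[of "unit_vec n i" "unit_vec k j"] f[OF A] f[OF B] by simp
qed (use A B in auto)

lemma quotient_isometry_unique:
  assumes vs: "vector_space scale" and U: "module.subspace scale U"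
    and A: "quadratic_mat A" and A': "quadratic_mat A'"
    and q: "quotient_isometry scale U q A \<phi>" and q': "quotient_isometry scale U q A' \<psi>"
  shows "isometric A A'"
proof -
  define n m where "n = dim_row A" and "m = dim_row A'"
  have c: "A \<in> carrier_mat n n" and c': "A' \<in> carrier_mat m m"
    using A A' quadratic_mat_carrier unfolding n_def m_def by auto
  obtain P where P: "P \<in> carrier_mat m n" "\<And>x. x \<in> U \<Longrightarrow> \<psi> x = P *\<^sub>v \<phi> x"
    using quotient_isometry_matrix[OF vs U c c' q q'] by blast
  obtain Q where Q: "Q \<in> carrier_mat n m" "\<And>x. x \<in> U \<Longrightarrow> \<phi> x = Q *\<^sub>v \<psi> x"
    using quotient_isometry_matrix[OF vs U c' c q' q] by blast
  have surj: "\<exists>x\<in>U. \<phi> x = v" if "v \<in> carrier_vec n" for v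
  proof -
    have "v \<in> \<phi> ` U" using q that unfolding quotient_isometry_def n_def by simp
    then show ?thesis by blast
  qed
  have surj': "\<exists>x\<in>U. \<psi> x = v" if "v \<in> carrier_vec m" for v
  proof -
    have "v \<in> \<psi> ` U" using q' that unfolding quotient_isometry_def m_def by simp
    then show ?thesis by blast
  qed
  have QP: "Q * P = 1\<^sub>m n"
  proof (rule mat_eq_by_form)
    fix v w :: "'a vec" assume w: "w \<in> carrier_vec n"
    from surj[OF w] obtain x where x: "x \<in> U" "\<phi> x = w" by blast
    have "(Q * P) *\<^sub>v w = Q *\<^sub>v (P *\<^sub>v w)" by (rule assoc_mult_mat_vec[OF Q(1) P(1) w])
    also have "P *\<^sub>v w = \<psi> x" using P(2)[OF x(1)] unfolding x(2) ..
    also have "Q *\<^sub>v \<psi> x = w" using Q(2)[OF x(1)] unfolding x(2) ..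
    finally have "(Q * P) *\<^sub>v w = w" .
    with w show "v \<bullet> ((Q * P) *\<^sub>v w) = v \<bullet> (1\<^sub>m n *\<^sub>v w)" by simp
  qed (use P Q in auto)
  have PQ: "P * Q = 1\<^sub>m m"
  proof (rule mat_eq_by_form)
    fix v w :: "'a vec" assume w: "w \<in> carrier_vec m"
    from surj'[OF w] obtain x where x: "x \<in> U" "\<psi> x = w" by blast
    have "(P * Q) *\<^sub>v w = P *\<^sub>v (Q *\<^sub>v w)" by (rule assoc_mult_mat_vec[OF P(1) Q(1) w])
    also have "Q *\<^sub>v w = \<phi> x" using Q(2)[OF x(1)] unfolding x(2) ..
    also have "P *\<^sub>v \<phi> x = w" using P(2)[OF x(1)] unfolding x(2) ..
    finally have "(P * Q) *\<^sub>v w = w" .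
    with w show "v \<bullet> ((P * Q) *\<^sub>v w) = v \<bullet> (1\<^sub>m m *\<^sub>v w)" by simp
  qed (use P Q in auto)
  have e: "A = transpose_mat P * A' * P"
  proof (rule mat_eq_by_form[OF c])
    show "transpose_mat P * A' * P \<in> carrier_mat n n"
      using P(1) c' by (metis mult_carrier_mat transpose_carrier_mat)
    fix v w :: "'a vec" assume v: "v \<in> carrier_vec n" and w: "w \<in> carrier_vec n"
    from surj[OF v] obtain x where x: "x \<in> U" "\<phi> x = v" by blast
    from surj[OF w] obtain y where y: "y \<in> U" "\<phi> y = w" by blast
    have Pt: "transpose_mat P \<in> carrier_mat n m" using P(1) by simp
    have Pv: "P *\<^sub>v v \<in> carrier_vec m" and Pw: "P *\<^sub>v w \<in> carrier_vec m"
      using mult_mat_vec_carrier[OF P(1)] v w by blast+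
    have APw: "A' *\<^sub>v (P *\<^sub>v w) \<in> carrier_vec m" by (rule mult_mat_vec_carrier[OF c' Pw])
    have "v \<bullet> (A *\<^sub>v w) = q x y" using q x y unfolding quotient_isometry_def by metis
    also have "\<dots> = \<psi> x \<bullet> (A' *\<^sub>v \<psi> y)" using q' x y unfolding quotient_isometry_def by metis
    also have "\<dots> = (P *\<^sub>v v) \<bullet> (A' *\<^sub>v (P *\<^sub>v w))" using P(2) x y by metis
    also have "\<dots> = v \<bullet> (transpose_mat P *\<^sub>v (A' *\<^sub>v (P *\<^sub>v w)))"
      using transpose_vec_mult_scalar[OF Pt APw v] by simp
    also have "transpose_mat P *\<^sub>v (A' *\<^sub>v (P *\<^sub>v w)) = (transpose_mat P * A' * P) *\<^sub>v w"
      using assoc_mult_mat_vec[OF mult_carrier_mat[OF Pt c'] P(1) w] assoc_mult_mat_vec[OF Pt c' Pw]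
      by simp
    finally show "v \<bullet> (A *\<^sub>v w) = v \<bullet> (transpose_mat P * A' * P *\<^sub>v w)" .
  qed
  show ?thesis
    by (rule isometricI[OF P(1) Q(1) PQ QP n_def[symmetric] m_def[symmetric] e])
qed

lemma witt_class_eq:
  assumes "vector_space scale" "module.subspace scale U"
    and "quadratic_mat A" "quotient_isometry scale U q A \<phi>"
  shows "witt_class scale U q = abs_witt A"
  unfolding witt_class_def
proof (rule the_equality)
  show "\<exists>A' \<psi>. quadratic_mat A' \<and> quotient_isometry scale U q A' \<psi> \<and> abs_witt A = abs_witt A'"
    using assms(3,4) by blast
  fix x assume "\<exists>A' \<psi>. quadratic_mat A' \<and> quotient_isometry scale U q A' \<psi> \<and> x = abs_witt A'"
  then obtain A' \<psi> where *: "quadratic_mat A'" "quotient_isometry scale U q A' \<psi>" "x = abs_witt A'"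
    by blast
  have "witt_equiv A' A"
    by (rule witt_equivI[OF *(1) assms(3) quotient_isometry_unique[OF assms(1,2) *(1) assms(3) *(2) assms(4)]])
  then show "x = abs_witt A"
    unfolding *(3) by (rule Quotient3_rel_abs[OF Quotient3_witt])
qed


section \<open>Symplectic spaces and Lagrangians\<close>

locale symplectic_space = finite_dimensional_vector_space scale Basis
  for scale :: "'a::field \<Rightarrow> 'v::ab_group_add \<Rightarrow> 'v" and Basis :: "'v set" +
  fixes B :: "'v \<Rightarrow> 'v \<Rightarrow> 'a"
  assumes linear_left: "Vector_Spaces.linear scale (*) (\<lambda>v. B v w)"
    and linear_right: "Vector_Spaces.linear scale (*) (\<lambda>w. B v w)"
    and alternating: "B v v = 0"
    and nondegenerate: "(\<And>w. B v w = 0) \<Longrightarrow> v = 0"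

definition lagrangian ::
  "('a::field \<Rightarrow> 'v \<Rightarrow> 'v::ab_group_add) \<Rightarrow> ('v \<Rightarrow> 'v \<Rightarrow> 'a) \<Rightarrow> 'v set \<Rightarrow> bool"
where
  "lagrangian scale B l \<longleftrightarrow> module.subspace scale l \<and> l = {v. \<forall>w\<in>l. B v w = 0}"

text \<open>
  Subspaces \<open>l\<^sub>1, \<dots>, l\<^sub>n\<close> are given by a list, and indices in \<open>\<int>/n\<int>\<close> are represented by
  \<open>0, \<dots>, n - 1\<close>.  The elements of the direct sum are the families \<open>w\<close> with \<open>w i \<in> ls ! i\<close>,
  extended by 0 to all \<open>i\<close>.
\<close>

definition direct_sum :: "'v::zero set list \<Rightarrow> (nat \<Rightarrow> 'v) set" where
  "direct_sum ls = {w. (\<forall>i<length ls. w i \<in> ls ! i) \<and> (\<forall>i\<ge>length ls. w i = 0)}"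

definition scale_family :: "('a \<Rightarrow> 'v \<Rightarrow> 'v) \<Rightarrow> 'a \<Rightarrow> (nat \<Rightarrow> 'v) \<Rightarrow> nat \<Rightarrow> 'v" where
  "scale_family scale c w = (\<lambda>i. scale c (w i))"


section \<open>The two indices\<close>

definition maslov_space :: "'v::ab_group_add set list \<Rightarrow> (nat \<Rightarrow> 'v) set" where
  "maslov_space ls = {w \<in> direct_sum ls. (\<Sum>i<length ls. w i) = 0}"

text \<open>Below, \<open>h i\<close> stands for the component of the anti-derivative indexed by the edge \<open>{i, i + 1}\<close>.\<close>

definition anti_derivative :: "nat \<Rightarrow> (nat \<Rightarrow> 'v::ab_group_add) \<Rightarrow> (nat \<Rightarrow> 'v) \<Rightarrow> bool" where
  "anti_derivative n w h \<longleftrightarrow> (\<forall>i<n. h i - h ((i + n - 1) mod n) = w i)"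

definition maslov_form ::
  "('v \<Rightarrow> 'v \<Rightarrow> 'a) \<Rightarrow> nat \<Rightarrow> (nat \<Rightarrow> 'v::ab_group_add) \<Rightarrow> (nat \<Rightarrow> 'v) \<Rightarrow> 'a::field"
where
  "maslov_form B n v w = (\<Sum>i<n. B (v i) ((SOME h. anti_derivative n w h) i))"

definition maslov_index ::
  "('a::field \<Rightarrow> 'v \<Rightarrow> 'v::ab_group_add) \<Rightarrow> ('v \<Rightarrow> 'v \<Rightarrow> 'a) \<Rightarrow> 'v set list \<Rightarrow> 'a witt"
where
  "maslov_index scale B ls =
     witt_class (scale_family scale) (maslov_space ls) (maslov_form B (length ls))"

definition kashiwara_form ::
  "('v \<Rightarrow> 'v \<Rightarrow> 'a) \<Rightarrow> (nat \<Rightarrow> 'v::ab_group_add) \<Rightarrow> (nat \<Rightarrow> 'v) \<Rightarrow> 'a::field"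
where
  "kashiwara_form B v w =
     1 / 2 * (B (v 0) (w 1 - w 2) + B (v 1) (w 2 - w 0) + B (v 2) (w 0 - w 1))"

text \<open>
  The relation \<open>kashiwara_value\<close> collects the results of all possible choices of \<open>k\<close> in the
  recursion for Kashiwara's index; the index is their common value.
\<close>

inductive kashiwara_value ::
  "('a::field \<Rightarrow> 'v \<Rightarrow> 'v::ab_group_add) \<Rightarrow> ('v \<Rightarrow> 'v \<Rightarrow> 'a) \<Rightarrow> 'v set list \<Rightarrow> 'a witt \<Rightarrow> bool"
  for scale B
where
  triple: "kashiwara_value scale B [l1, l2, l3]
     (witt_class (scale_family scale) (direct_sum [l1, l2, l3]) (kashiwara_form B))"
| split: "k \<in> {3..length ls - 1} \<Longrightarrow>
     kashiwara_value scale B (take k ls) s \<Longrightarrow>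
     kashiwara_value scale B (hd ls # drop (k - 1) ls) t \<Longrightarrow>
     kashiwara_value scale B ls (s + t)"

definition kashiwara_index ::
  "('a::field \<Rightarrow> 'v \<Rightarrow> 'v::ab_group_add) \<Rightarrow> ('v \<Rightarrow> 'v \<Rightarrow> 'a) \<Rightarrow> 'v set list \<Rightarrow> 'a witt"
where
  "kashiwara_index scale B ls = (THE x. kashiwara_value scale B ls x)"

end

theory Submission
  imports Defs "Jordan_Normal_Form.Determinant" "HOL-Library.Product_Plus"
begin

text \<open>
  Both indices are classes of symmetric forms, and every comparison below rests on one principle,
  \<open>witt_class_coisotropic_reduction\<close>: if \<open>U\<^sub>0\<close> is a subspace of \<open>U\<close> that contains its own orthogonal
  complement, and \<open>f\<close> maps \<open>U\<^sub>0\<close> onto \<open>U'\<close> and preserves the forms, then \<open>U\<close> and \<open>U'\<close> have the same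
  class.  Modulo the radicals, the graph of \<open>f\<close> is then a Lagrangian of \<open>U \<oplus> U'\<close> with the sign of the
  second form reversed.

  On the space \<open>K\<close> of families with sum zero the anti-derivative can be normalised to the partial sums \<open>w\<^sub>1 + \<dots> + w\<^sub>i\<close>, so that the Maslov
  form becomes \<open>\<Sum>\<^sub>i B (v\<^sub>i, w\<^sub>1 + \<dots> + w\<^sub>i)\<close> (\<open>maslov_form_eq\<close>).

  For three Lagrangians, the first summand \<open>l\<^sub>1\<close> is isotropic for Kashiwara's form and its complement is
  given by \<open>v\<^sub>2 - v\<^sub>3 \<in> l\<^sub>1\<close>.  There \<open>v \<mapsto> (v\<^sub>3 - v\<^sub>2, v\<^sub>2, - v\<^sub>3)\<close> preserves the forms and is onto
  \<open>K\<close>, so the two indices agree (\<open>kashiwara_triple_eq_maslov_index\<close>).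

  In general it suffices that \<open>\<tau>\<close> obeys Kashiwara's recursion (\<open>maslov_index_cut\<close>).  Cut the polygon
  with vertices \<open>1, \<dots>, n\<close> along the diagonal from \<open>1\<close> to \<open>k\<close>.  Adding the components at the two common
  vertices maps the product of the spaces \<open>K\<close> of the two pieces to \<open>K\<close> of the whole polygon, and preserves
  the forms.  The image consists of the \<open>w\<close>
  with \<open>w\<^sub>1 + \<dots> + w\<^bsub>k - 1\<^esub> \<in> l\<^sub>1 + l\<^sub>k\<close>.  It contains its complement, because a vector orthogonal to
  \<open>l\<^sub>1 \<inter> l\<^sub>k\<close> lies in \<open>l\<^sub>1 + l\<^sub>k\<close>; so reduction shows that the class of the whole is the sum of the classes of
  the pieces.  By induction every value of the recursion is \<open>\<tau>\<close>.
\<close>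

section \<open>Symmetric forms and the quadratic spaces they represent\<close>

locale symmetric_form = vector_space scale
  for scale :: "'a::field \<Rightarrow> 'v::ab_group_add \<Rightarrow> 'v" +
  fixes U :: "'v set" and q :: "'v \<Rightarrow> 'v \<Rightarrow> 'a"
  assumes subspace_U: "subspace U"
    and finite_span: "\<exists>S. finite S \<and> U \<subseteq> span S"
    and form_add: "\<lbrakk>x \<in> U; y \<in> U; z \<in> U\<rbrakk> \<Longrightarrow> q (x + y) z = q x z + q y z"
    and form_scale: "\<lbrakk>x \<in> U; z \<in> U\<rbrakk> \<Longrightarrow> q (scale c x) z = c * q x z"
    and form_sym: "\<lbrakk>x \<in> U; y \<in> U\<rbrakk> \<Longrightarrow> q x y = q y x"
begin

lemma form_zero: "z \<in> U \<Longrightarrow> q 0 z = 0"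
  using form_scale[of 0 z 0] subspace_0[OF subspace_U] by simp

lemma form_sum:
  assumes "\<And>i. i \<in> I \<Longrightarrow> u i \<in> U" "z \<in> U"
  shows "q (\<Sum>i\<in>I. scale (c i) (u i)) z = (\<Sum>i\<in>I. c i * q (u i) z)"
  using assms(1)
proof (induction I rule: infinite_finite_induct)
  case (insert i I)
  have "(\<Sum>i\<in>I. scale (c i) (u i)) \<in> U"
    using insert.prems by (intro subspace_sum subspace_scale subspace_U) auto
  moreover have "scale (c i) (u i) \<in> U" using insert.prems by (intro subspace_scale subspace_U) auto
  ultimately show ?case
    using insert assms(2) by (simp add: form_add form_scale)
qed (simp_all add: form_zero assms(2))

lemma subspace_radical: "subspace (form_radical U q)"
  unfolding form_radical_def
  by (rule subspaceI)
    (auto simp: form_zero form_add form_scale subspace_0[OF subspace_U] subspace_add[OF subspace_U]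
      subspace_scale[OF subspace_U])

lemma subset:
  assumes "subspace W" "W \<subseteq> U"
  shows "symmetric_form scale W q"
proof unfold_locales
  show "\<exists>S. finite S \<and> W \<subseteq> span S" using finite_span assms(2) by (meson order_trans)
qed (simp_all add: assms(1) subsetD[OF assms(2)] form_add form_scale form_sym)

text \<open>
  A basis of the radical extends to a basis of \<open>U\<close>.  The coordinates along the added basis vectors
  are coordinates of \<open>U\<close> modulo the radical, and the Gram matrix of the added vectors is
  invertible because a vector in its kernel would lie in the radical.
\<close>

lemma quotient_isometry_exists:
  "\<exists>A \<phi>. quadratic_mat A \<and> quotient_isometry scale U q A \<phi>"
proof -
  let ?R = "form_radical U q"
  have RU: "?R \<subseteq> U" unfolding form_radical_def by blast
  obtain C0 where C0: "C0 \<subseteq> ?R" "independent C0" "?R \<subseteq> span C0"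
    using maximal_independent_subset by blast
  then have "C0 \<subseteq> U" using RU by blast
  then obtain C where C: "C0 \<subseteq> C" "C \<subseteq> U" "independent C" "U \<subseteq> span C"
    using maximal_independent_subset_extend C0(2) by metis
  obtain S where "finite S" "U \<subseteq> span S" using finite_span by blast
  then have finC: "finite C" using independent_span_bound C by blast
  have spanC0: "span C0 = ?R"
    by (rule antisym[OF span_minimal[OF C0(1) subspace_radical] C0(3)])
  obtain cs where cs: "distinct cs" "set cs = C - C0"
    using finite_distinct_list[of "C - C0"] finC by auto
  define n where "n = length cs"
  have csC: "cs ! i \<in> C" "cs ! i \<in> U" if "i < n" for i
    using cs that nth_mem[of i cs] C unfolding n_def by blast+
  define \<phi> where "\<phi> u = vec n (\<lambda>i. representation C u (cs ! i))" for u
  define A where "A = mat n n (\<lambda>(i, j). q (cs ! i) (cs ! j))"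
  define lift where "lift x = (\<Sum>i<n. scale (x $ i) (cs ! i))" for x :: "'a vec"
  have Ac: "A \<in> carrier_mat n n" unfolding A_def by simp
  have dA: "dim_row A = n" using Ac by simp
  have \<phi>c: "\<phi> u \<in> carrier_vec n" for u unfolding \<phi>_def by simp
  have liftU: "lift x \<in> U" for x
    unfolding lift_def by (intro subspace_sum subspace_scale subspace_U csC) auto
  have \<phi>_lift: "\<phi> (lift x) = x" if x: "x \<in> carrier_vec n" for x
  proof (rule eq_vecI)
    fix j assume "j < dim_vec x"
    then have j: "j < n" using x by simp
    have "representation C (lift x) (cs ! j) = (\<Sum>i<n. representation C (scale (x $ i) (cs ! i)) (cs ! j))"
      unfolding lift_def using C(3,4) csC
      by (subst representation_sum) (auto intro!: span_scale)
    also have "\<dots> = (\<Sum>i<n. if i = j then x $ i else 0)"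
    proof (rule sum.cong[OF refl])
      fix i assume "i \<in> {..<n}"
      then have i: "i < n" by simp
      have "(cs ! i = cs ! j) = (i = j)"
        using cs(1) i j unfolding n_def by (simp add: nth_eq_iff_index_eq)
      then show "representation C (scale (x $ i) (cs ! i)) (cs ! j) = (if i = j then x $ i else 0)"
        using C(3,4) csC[OF i] by (subst representation_scale) (auto simp: representation_basis)
    qed
    also have "\<dots> = x $ j" using j by simp
    finally show "\<phi> (lift x) $ j = x $ j" using j by (simp add: \<phi>_def)
  qed (use x \<phi>c in auto)
  have decomp: "\<exists>r\<in>?R. u = r + lift (\<phi> u)" if u: "u \<in> U" for u
  proof -
    have uC: "u \<in> span C" using C(4) u by blast
    have "u = (\<Sum>b\<in>C. scale (representation C u b) b)"
      using sum_representation_eq[OF C(3) uC finC subset_refl] ..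
    also have "\<dots> = (\<Sum>b\<in>C0. scale (representation C u b) b)
        + (\<Sum>b\<in>set cs. scale (representation C u b) b)"
      using sum.subset_diff[OF C(1) finC, of "\<lambda>b. scale (representation C u b) b"] cs(2)
      by (simp add: add.commute)
    also have "(\<Sum>b\<in>set cs. scale (representation C u b) b) = lift (\<phi> u)"
    proof -
      have "bij_betw (nth cs) {..<n} (set cs)"
        using bij_betw_nth[OF cs(1) refl refl] unfolding n_def .
      then show ?thesis unfolding lift_def \<phi>_def by (simp add: sum.reindex_bij_betw[symmetric])
    qed
    finally have "u = (\<Sum>b\<in>C0. scale (representation C u b) b) + lift (\<phi> u)" .
    moreover have "(\<Sum>b\<in>C0. scale (representation C u b) b) \<in> ?R"
      unfolding spanC0[symmetric] by (intro span_sum span_scale span_base)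
    ultimately show ?thesis by blast
  qed
  have form_lift: "q u v = q (lift (\<phi> u)) v" if u: "u \<in> U" and v: "v \<in> U" for u v
  proof -
    obtain r where r: "r \<in> ?R" and e: "u = r + lift (\<phi> u)" using decomp[OF u] by blast
    have "q u v = q r v + q (lift (\<phi> u)) v"
      by (subst e, rule form_add) (use r RU liftU v in auto)
    then show ?thesis using r v unfolding form_radical_def by auto
  qed
  have form: "q u v = \<phi> u \<bullet> (A *\<^sub>v \<phi> v)" if u: "u \<in> U" and v: "v \<in> U" for u v
  proof -
    have "q u v = (\<Sum>i<n. \<phi> u $ i * q (cs ! i) v)"
      unfolding form_lift[OF u v] by (subst (1) lift_def, rule form_sum) (use csC v in auto)
    also have "\<dots> = (\<Sum>i<n. \<phi> u $ i * (\<Sum>j<n. q (cs ! i) (cs ! j) * \<phi> v $ j))"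
    proof (intro sum.cong refl arg_cong2[of _ _ _ _ "(*)"])
      fix i assume "i \<in> {..<n}"
      then have i: "i < n" by simp
      have "q (cs ! i) v = q (lift (\<phi> v)) (cs ! i)"
        using form_sym[OF csC(2)[OF i] v] form_lift[OF v csC(2)[OF i]] by simp
      also have "\<dots> = (\<Sum>j<n. \<phi> v $ j * q (cs ! j) (cs ! i))"
        unfolding lift_def by (rule form_sum) (use csC i in auto)
      also have "\<dots> = (\<Sum>j<n. q (cs ! i) (cs ! j) * \<phi> v $ j)"
        by (intro sum.cong refl) (use csC i form_sym in \<open>auto simp: mult.commute\<close>)
      finally show "q (cs ! i) v = \<dots>" .
    qed
    also have "\<dots> = \<phi> u \<bullet> (A *\<^sub>v \<phi> v)"
      using \<phi>c[of v] unfolding A_def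
      by (auto simp: scalar_prod_def atLeast0LessThan intro!: sum.cong)
    finally show ?thesis .
  qed
  have sym: "transpose_mat A = A"
    unfolding A_def by (rule eq_matI) (auto intro: form_sym csC)
  have \<phi>_radical: "\<phi> u = 0\<^sub>v n \<longleftrightarrow> u \<in> ?R" if u: "u \<in> U" for u
  proof
    assume "\<phi> u = 0\<^sub>v n"
    then have "lift (\<phi> u) = 0" unfolding lift_def by (auto intro!: sum.neutral)
    then show "u \<in> ?R" using decomp[OF u] by auto
  next
    assume "u \<in> ?R"
    then have "u \<in> span C0" using spanC0 by simp
    then have *: "representation C u = representation C0 u"
      by (rule representation_extend[OF C(3) _ C(1)])
    have "representation C u (cs ! i) = 0" if i: "i < n" for i
    proof -
      have "cs ! i \<notin> C0" using nth_mem[of i cs] i cs(2) unfolding n_def by blast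
      then show ?thesis unfolding * using representation_ne_zero by blast
    qed
    then show "\<phi> u = 0\<^sub>v n" unfolding \<phi>_def by auto
  qed
  have "det A \<noteq> 0"
  proof
    assume "det A = 0"
    then obtain x where x: "x \<in> carrier_vec n" "x \<noteq> 0\<^sub>v n" "A *\<^sub>v x = 0\<^sub>v n"
      using det_0_iff_vec_prod_zero_field[OF Ac] by blast
    have "q (lift x) v = 0" if v: "v \<in> U" for v
    proof -
      have "q (lift x) v = q v (lift x)" by (rule form_sym[OF liftU v])
      also have "\<dots> = 0" using form[OF v liftU[of x]] x \<phi>_lift \<phi>c[of v] by simp
      finally show ?thesis .
    qed
    then have "lift x \<in> ?R" using liftU unfolding form_radical_def by blast
    then have "\<phi> (lift x) = 0\<^sub>v n" by (rule iffD2[OF \<phi>_radical[OF liftU]])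
    then show False using \<phi>_lift[OF x(1)] x(2) by simp
  qed
  then obtain Q where Q: "Q \<in> carrier_mat n n" "Q * A = 1\<^sub>m n"
    using det_non_zero_imp_unit[OF Ac, of undefined] unfolding Units_def ring_mat_def by auto
  have "quadratic_mat A"
    by (rule quadratic_matI[OF Ac Q(1) mat_mult_left_right_inverse[OF Q(1) Ac Q(2)] Q(2) sym])
  moreover have "quotient_isometry scale U q A \<phi>"
    unfolding quotient_isometry_def dA
  proof (intro conjI ballI allI)
    show "\<phi> ` U = carrier_vec n"
      using \<phi>c \<phi>_lift liftU by (auto simp: image_iff) metis
    show "\<phi> (u + v) = \<phi> u + \<phi> v" if "u \<in> U" "v \<in> U" for u v
      unfolding \<phi>_def using representation_add[OF C(3), of v u] subsetD[OF C(4)] that by (intro eq_vecI) auto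
    show "\<phi> (scale c u) = c \<cdot>\<^sub>v \<phi> u" if "u \<in> U" for c u
      unfolding \<phi>_def using representation_scale[OF C(3), of u c] subsetD[OF C(4)] that by (intro eq_vecI) auto
    show "{u \<in> U. \<phi> u = 0\<^sub>v n} = ?R" using \<phi>_radical RU by blast
  qed (rule form)
  ultimately show ?thesis by blast
qed

end

text \<open>
  Fixing the coordinates \<open>\<phi>\<close> and the matrix \<open>A\<close> lets representations of two forms be combined into one
  of their product.
\<close>

locale represented_form = vector_space scale
  for scale :: "'a::field \<Rightarrow> 'v::ab_group_add \<Rightarrow> 'v" +
  fixes U :: "'v set" and q :: "'v \<Rightarrow> 'v \<Rightarrow> 'a" and A :: "'a mat" and \<phi> :: "'v \<Rightarrow> 'a vec"
  assumes subspace_U: "subspace U"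
    and quadratic: "quadratic_mat A"
    and isometry: "quotient_isometry scale U q A \<phi>"
begin

lemma witt_class: "witt_class scale U q = abs_witt A"
  by (rule witt_class_eq[OF vector_space_axioms subspace_U quadratic isometry])

lemma carrier_A: "A \<in> carrier_mat (dim_row A) (dim_row A)"
  by (rule quadratic_mat_carrier[OF quadratic])

lemma phi_carrier: "u \<in> U \<Longrightarrow> \<phi> u \<in> carrier_vec (dim_row A)"
  using isometry unfolding quotient_isometry_def by blast

lemma phi_surj: "v \<in> carrier_vec (dim_row A) \<Longrightarrow> \<exists>u\<in>U. v = \<phi> u"
  using isometry unfolding quotient_isometry_def by blast

lemma form_eq: "u \<in> U \<Longrightarrow> v \<in> U \<Longrightarrow> q u v = \<phi> u \<bullet> (A *\<^sub>v \<phi> v)"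
  using isometry unfolding quotient_isometry_def by blast

lemma phi_diff:
  assumes "u \<in> U" "v \<in> U"
  shows "\<phi> (u - v) = \<phi> u - \<phi> v"
proof -
  have "u - v \<in> U" by (rule subspace_diff[OF subspace_U assms])
  then have "\<phi> (u - v + v) = \<phi> (u - v) + \<phi> v"
    using isometry assms unfolding quotient_isometry_def by blast
  then show ?thesis
    using phi_carrier[of "u - v"] phi_carrier[of v] \<open>u - v \<in> U\<close> assms by auto
qed

lemma form_diff:
  assumes "u \<in> U" "v \<in> U" "w \<in> U"
  shows "q (u - v) w = q u w - q v w"
proof -
  have "u - v \<in> U" by (rule subspace_diff[OF subspace_U assms(1,2)])
  moreover have "A *\<^sub>v \<phi> w \<in> carrier_vec (dim_row A)"
    using mult_mat_vec_carrier[OF carrier_A phi_carrier] assms by blast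
  ultimately show ?thesis
    using assms minus_scalar_prod_distrib[OF phi_carrier[OF assms(1)] phi_carrier[OF assms(2)]]
    by (simp add: form_eq phi_diff)
qed

lemma form_zero_right:
  assumes "v \<in> U"
  shows "q v 0 = 0"
proof -
  define n where "n = dim_row A"
  have A: "A \<in> carrier_mat n n" unfolding n_def by (rule carrier_A)
  have z: "0 \<in> U" by (rule subspace_0[OF subspace_U])
  have c: "\<phi> 0 \<in> carrier_vec n" "\<phi> v \<in> carrier_vec n"
    using phi_carrier z assms unfolding n_def by blast+
  have "\<phi> 0 = 0\<^sub>v n" using phi_diff[OF z z] c(1) by simp
  moreover have "A *\<^sub>v 0\<^sub>v n = 0\<^sub>v n" using A by auto
  ultimately show ?thesis using form_eq[OF assms z] c(2) by simp
qed

lemma phi_eqI: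
  assumes "u \<in> U" "v \<in> U" "\<And>w. w \<in> U \<Longrightarrow> q u w = q v w"
  shows "\<phi> u = \<phi> v"
proof -
  have "u - v \<in> form_radical U q"
    using assms form_diff subspace_diff[OF subspace_U] unfolding form_radical_def by auto
  then have "\<phi> u - \<phi> v = 0\<^sub>v (dim_row A)"
    using isometry assms unfolding phi_diff[OF assms(1,2), symmetric] quotient_isometry_def by blast
  then show ?thesis
    using phi_carrier[OF assms(1)] phi_carrier[OF assms(2)]
    by (metis carrier_vecD eq_iff_diff_eq_0 eq_vecI index_minus_vec(1) index_zero_vec(1))
qed

end

lemma (in symmetric_form) obtain_representation:
  obtains A \<phi> where "represented_form scale U q A \<phi>"
  using quotient_isometry_exists subspace_U by (metis represented_form_axioms_def represented_form_def vector_space_axioms)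

section \<open>Reduction and additivity in the Witt group\<close>

lemma abs_witt_eq_if_metabolic:
  assumes "quadratic_mat A" "quadratic_mat A'" "metabolic (orth_sum A (- A'))"
  shows "abs_witt A = abs_witt A'"
proof -
  note r = witt_equiv_refl[OF assms(1)] witt_equiv_refl[OF assms(2)]
    witt_equiv_refl[OF quadratic_uminus[OF assms(2)]]
  have "abs_witt (orth_sum A (- A')) = abs_witt zero_form"
    by (rule Quotient3_rel_abs[OF Quotient3_witt witt_equiv_metabolic[OF assms(3)]])
  then have "abs_witt A + - abs_witt A' = 0"
    by (simp add: plus_witt.abs_eq[OF r(1,3)] uminus_witt.abs_eq[OF r(2)] zero_witt_def)
  then show ?thesis by (simp add: eq_neg_iff_add_eq_0[symmetric])
qed

text \<open>
  The graph of \<open>f\<close> is its own orthogonal complement in \<open>U \<oplus> U'\<close>, up to the radicals,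
  when the second summand carries \<open>- q'\<close>.  Indeed, if \<open>(u, f y)\<close> is orthogonal to the graph, then \<open>u - y\<close> is
  orthogonal to \<open>U\<^sub>0\<close>, hence in \<open>U\<^sub>0\<close>; so \<open>u \<in> U\<^sub>0\<close>, and \<open>f u\<close> and \<open>f y\<close> agree modulo the radical.
\<close>

lemma witt_class_coisotropic_reduction:
  assumes "represented_form s U q A \<phi>" "represented_form s' U' q' A' \<phi>'"
    and U0: "module.subspace s U0" "U0 \<subseteq> U"
    and coisotropic: "\<And>u. u \<in> U \<Longrightarrow> (\<And>x. x \<in> U0 \<Longrightarrow> q u x = 0) \<Longrightarrow> u \<in> U0"
    and f: "f ` U0 = U'"
    and f_isometry: "\<And>x y. x \<in> U0 \<Longrightarrow> y \<in> U0 \<Longrightarrow> q' (f x) (f y) = q x y"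
  shows "witt_class s U q = witt_class s' U' q'"
proof -
  interpret Q: represented_form s U q A \<phi> by fact
  interpret Q': represented_form s' U' q' A' \<phi>' by fact
  define n m where "n = dim_row A" and "m = dim_row A'"
  have A: "A \<in> carrier_mat n n" unfolding n_def by (rule Q.carrier_A)
  have A': "- A' \<in> carrier_mat m m"
    unfolding m_def uminus_carrier_iff_mat by (rule Q'.carrier_A)
  have fU: "f x \<in> U'" if "x \<in> U0" for x using f that by blast
  define L where "L = (\<lambda>x. \<phi> x @\<^sub>v \<phi>' (f x)) ` U0"
  \<comment> \<open>The product of \<open>U\<close> and \<open>U'\<close>, with the form \<open>q - q'\<close>, seen in coordinates.\<close>
  have form_graph: "(\<phi> u @\<^sub>v \<phi>' u') \<bullet> (orth_sum A (- A') *\<^sub>v (\<phi> v @\<^sub>v \<phi>' v')) = q u v - q' u' v'"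
    if "u \<in> U" "v \<in> U" "u' \<in> U'" "v' \<in> U'" for u v u' v'
  proof -
    have c: "\<phi> u \<in> carrier_vec n" "\<phi> v \<in> carrier_vec n" "\<phi>' u' \<in> carrier_vec m" "\<phi>' v' \<in> carrier_vec m"
      using that Q.phi_carrier Q'.phi_carrier unfolding n_def m_def by auto
    have "(- A') *\<^sub>v \<phi>' v' = - (A' *\<^sub>v \<phi>' v')"
      using A' c(4) by (intro eq_vecI) auto
    then show ?thesis
      using that c A' by (simp add: orth_sum_form[OF A A' c(1,2,3,4)] Q.form_eq Q'.form_eq)
  qed
  have "L = {v \<in> carrier_vec (n + m). \<forall>w\<in>L. v \<bullet> (orth_sum A (- A') *\<^sub>v w) = 0}"
  proof (intro equalityI subsetI CollectI conjI ballI)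
    fix v assume "v \<in> L"
    then obtain x where x: "x \<in> U0" and v: "v = \<phi> x @\<^sub>v \<phi>' (f x)" unfolding L_def by blast
    show "v \<in> carrier_vec (n + m)"
      unfolding v n_def m_def using Q.phi_carrier Q'.phi_carrier x U0 fU by auto
    fix w assume "w \<in> L"
    then obtain y where y: "y \<in> U0" and w: "w = \<phi> y @\<^sub>v \<phi>' (f y)" unfolding L_def by blast
    show "v \<bullet> (orth_sum A (- A') *\<^sub>v w) = 0"
      unfolding v w using x y U0(2) fU f_isometry by (subst form_graph) auto
  next
    fix v assume v: "v \<in> {v \<in> carrier_vec (n + m). \<forall>w\<in>L. v \<bullet> (orth_sum A (- A') *\<^sub>v w) = 0}"
    have "vec_first v n \<in> carrier_vec (dim_row A)" "vec_last v m \<in> carrier_vec (dim_row A')"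
      unfolding n_def m_def by auto
    then obtain u u' where u: "u \<in> U" "vec_first v n = \<phi> u" and u': "u' \<in> U'" "vec_last v m = \<phi>' u'"
      using Q.phi_surj Q'.phi_surj by blast
    obtain y where y: "y \<in> U0" "u' = f y" using u'(1) f by blast
    have vu: "v = \<phi> u @\<^sub>v \<phi>' u'" using v by (simp flip: u(2) u'(2))
    have orth: "q u x = q' u' (f x)" if x: "x \<in> U0" for x
    proof -
      have "v \<bullet> (orth_sum A (- A') *\<^sub>v (\<phi> x @\<^sub>v \<phi>' (f x))) = 0" using v x unfolding L_def by blast
      moreover have "v \<bullet> (orth_sum A (- A') *\<^sub>v (\<phi> x @\<^sub>v \<phi>' (f x))) = q u x - q' u' (f x)"
        unfolding vu by (rule form_graph) (use x u u' U0(2) fU in blast)+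
      ultimately show ?thesis by simp
    qed
    have "u - y \<in> U0"
    proof (rule coisotropic)
      show "u - y \<in> U" using Q.subspace_diff[OF Q.subspace_U u(1)] y U0(2) by blast
      fix x assume x: "x \<in> U0"
      have "q (u - y) x = q u x - q y x" using u y x U0(2) by (intro Q.form_diff) auto
      then show "q (u - y) x = 0" using orth[OF x] f_isometry[OF y(1) x] y(2) by simp
    qed
    then have uU0: "u \<in> U0" using Q.subspace_add[OF U0(1) _ y(1), of "u - y"] by simp
    have "\<phi>' u' = \<phi>' (f u)"
    proof (rule Q'.phi_eqI[OF u'(1) fU[OF uU0]])
      fix w assume "w \<in> U'"
      then obtain x where "x \<in> U0" "w = f x" using f by blast
      then show "q' u' w = q' (f u) w" using orth f_isometry[OF uU0] by simp
    qed
    with uU0 show "v \<in> L" unfolding L_def vu by (auto intro!: image_eqI[of _ _ u])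
  qed
  then have "metabolic (orth_sum A (- A'))"
    by (rule metabolicI[OF quadratic_orth_sum[OF Q.quadratic quadratic_uminus[OF Q'.quadratic]]
          orth_sum_carrier[OF A A']])
  then show ?thesis
    unfolding Q.witt_class Q'.witt_class
    by (rule abs_witt_eq_if_metabolic[OF Q.quadratic Q'.quadratic])
qed

definition scale_prod :: "('a \<Rightarrow> 'v \<Rightarrow> 'v) \<Rightarrow> ('a \<Rightarrow> 'w \<Rightarrow> 'w) \<Rightarrow> 'a \<Rightarrow> 'v \<times> 'w \<Rightarrow> 'v \<times> 'w" where
  "scale_prod s s' c = map_prod (s c) (s' c)"

definition form_prod :: "('v \<Rightarrow> 'v \<Rightarrow> 'a::plus) \<Rightarrow> ('w \<Rightarrow> 'w \<Rightarrow> 'a) \<Rightarrow> 'v \<times> 'w \<Rightarrow> 'v \<times> 'w \<Rightarrow> 'a" where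
  "form_prod q q' x y = q (fst x) (fst y) + q' (snd x) (snd y)"

lemma represented_form_prod:
  assumes "represented_form s U q A \<phi>" "represented_form s' U' q' A' \<phi>'"
  shows "represented_form (scale_prod s s') (U \<times> U') (form_prod q q') (orth_sum A A')
    (\<lambda>x. \<phi> (fst x) @\<^sub>v \<phi>' (snd x))"
proof -
  interpret Q: represented_form s U q A \<phi> by fact
  interpret Q': represented_form s' U' q' A' \<phi>' by fact
  interpret P: vector_space "scale_prod s s'"
    by unfold_locales
      (auto simp: scale_prod_def prod_eq_iff Q.scale_right_distrib Q'.scale_right_distrib
        Q.scale_left_distrib Q'.scale_left_distrib)
  let ?\<phi> = "\<lambda>x. \<phi> (fst x) @\<^sub>v \<phi>' (snd x)"
  note c = Q.phi_carrier Q'.phi_carrier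
  have z: "0 \<in> U" "0 \<in> U'" using Q.subspace_0[OF Q.subspace_U] Q'.subspace_0[OF Q'.subspace_U] .
  have right0: "q v 0 = 0" if "v \<in> U" for v by (rule Q.form_zero_right[OF that])
  have right0': "q' v 0 = 0" if "v \<in> U'" for v by (rule Q'.form_zero_right[OF that])
  have rad: "form_radical (U \<times> U') (form_prod q q') = form_radical U q \<times> form_radical U' q'"
  proof (intro equalityI subsetI)
    fix x assume "x \<in> form_radical (U \<times> U') (form_prod q q')"
    then obtain u u' where x: "x = (u, u')" "u \<in> U" "u' \<in> U'"
      and r: "\<And>v v'. v \<in> U \<Longrightarrow> v' \<in> U' \<Longrightarrow> q u v + q' u' v' = 0"
      unfolding form_radical_def form_prod_def by force
    have "q u v = 0" if "v \<in> U" for v using r[OF that z(2)] right0'[OF x(3)] by simp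
    moreover have "q' u' v = 0" if "v \<in> U'" for v using r[OF z(1) that] right0[OF x(2)] by simp
    ultimately show "x \<in> form_radical U q \<times> form_radical U' q'"
      unfolding form_radical_def using x by simp
  qed (auto simp: form_radical_def form_prod_def)
  show ?thesis
  proof unfold_locales
    show "P.subspace (U \<times> U')"
      using Q.subspace_U Q'.subspace_U
      by (intro P.subspaceI)
        (auto simp: scale_prod_def zero_prod_def z Q.subspace_add Q'.subspace_add Q.subspace_scale Q'.subspace_scale)
    show "quadratic_mat (orth_sum A A')" by (rule quadratic_orth_sum[OF Q.quadratic Q'.quadratic])
    have lin: "\<phi> (u + v) = \<phi> u + \<phi> v" "\<phi> (s a u) = a \<cdot>\<^sub>v \<phi> u" if "u \<in> U" "v \<in> U" for u v a
      using Q.isometry that unfolding quotient_isometry_def by blast+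
    have lin': "\<phi>' (u + v) = \<phi>' u + \<phi>' v" "\<phi>' (s' a u) = a \<cdot>\<^sub>v \<phi>' u" if "u \<in> U'" "v \<in> U'" for u v a
      using Q'.isometry that unfolding quotient_isometry_def by blast+
    have ker: "{u \<in> U. \<phi> u = 0\<^sub>v (dim_row A)} = form_radical U q"
      "{u \<in> U'. \<phi>' u = 0\<^sub>v (dim_row A')} = form_radical U' q'"
      using Q.isometry Q'.isometry unfolding quotient_isometry_def by blast+
    have zapp: "0\<^sub>v (dim_row A + dim_row A') = 0\<^sub>v (dim_row A) @\<^sub>v 0\<^sub>v (dim_row A')"
      by (intro eq_vecI) auto
    show "quotient_isometry (scale_prod s s') (U \<times> U') (form_prod q q') (orth_sum A A') ?\<phi>"
      unfolding quotient_isometry_def orth_sum_dim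
    proof (intro conjI ballI allI)
      show "?\<phi> ` (U \<times> U') = carrier_vec (dim_row A + dim_row A')"
      proof (intro equalityI subsetI)
        fix v :: "'a vec" assume v: "v \<in> carrier_vec (dim_row A + dim_row A')"
        obtain u u' where u: "u \<in> U" "vec_first v (dim_row A) = \<phi> u"
            "u' \<in> U'" "vec_last v (dim_row A') = \<phi>' u'"
          using Q.phi_surj[of "vec_first v (dim_row A)"] Q'.phi_surj[of "vec_last v (dim_row A')"]
          by auto
        have "v = ?\<phi> (u, u')" using v by (simp flip: u(2,4))
        then show "v \<in> ?\<phi> ` (U \<times> U')" using u by blast
      qed (auto intro!: append_carrier_vec c)
      show "?\<phi> (u + v) = ?\<phi> u + ?\<phi> v" if "u \<in> U \<times> U'" "v \<in> U \<times> U'" for u v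
      proof -
        have "fst u \<in> U" "snd u \<in> U'" "fst v \<in> U" "snd v \<in> U'" using that by auto
        then show ?thesis by (simp add: lin lin' append_vec_add[OF c(1) c(1) c(2) c(2)])
      qed
      show "?\<phi> (scale_prod s s' a u) = a \<cdot>\<^sub>v ?\<phi> u" if "u \<in> U \<times> U'" for a u
      proof -
        have u: "fst u \<in> U" "snd u \<in> U'" using that by auto
        from c(1)[OF u(1)] c(2)[OF u(2)] show ?thesis
          unfolding scale_prod_def fst_map_prod snd_map_prod lin(2)[OF u(1) u(1)] lin'(2)[OF u(2) u(2)]
          by (intro eq_vecI) auto
      qed
      show "{u \<in> U \<times> U'. ?\<phi> u = 0\<^sub>v (dim_row A + dim_row A')} = form_radical (U \<times> U') (form_prod q q')"
        unfolding rad ker[symmetric] zapp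
        by (auto simp: append_vec_eq[OF c(1) zero_carrier_vec])
      show "form_prod q q' u v = ?\<phi> u \<bullet> (orth_sum A A' *\<^sub>v ?\<phi> v)" if "u \<in> U \<times> U'" "v \<in> U \<times> U'" for u v
      proof -
        have "fst u \<in> U" "snd u \<in> U'" "fst v \<in> U" "snd v \<in> U'" using that by auto
        then show ?thesis
          by (simp add: form_prod_def Q.form_eq Q'.form_eq
              orth_sum_form[OF Q.carrier_A Q'.carrier_A c(1) c(1) c(2) c(2)])
      qed
    qed
  qed
qed

lemma witt_class_prod:
  assumes "represented_form s U q A \<phi>" "represented_form s' U' q' A' \<phi>'"
  shows "witt_class (scale_prod s s') (U \<times> U') (form_prod q q') = witt_class s U q + witt_class s' U' q'"
  unfolding represented_form.witt_class[OF assms(1)] represented_form.witt_class[OF assms(2)]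
    represented_form.witt_class[OF represented_form_prod[OF assms]]
  using assms[THEN represented_form.quadratic]
  by (simp add: plus_witt.abs_eq witt_equiv_refl)

section \<open>Complements of Lagrangian subspaces\<close>

context symplectic_space
begin

sublocale left: Vector_Spaces.linear scale "(*)" "\<lambda>v. B v w" for w by (rule linear_left)
sublocale right: Vector_Spaces.linear scale "(*)" "\<lambda>w. B v w" for v by (rule linear_right)

sublocale functional: vector_space_pair scale "(*) :: 'a \<Rightarrow> 'a \<Rightarrow> 'a"
  by unfold_locales (simp_all add: algebra_simps)

lemmas B_simps = left.add left.diff left.neg left.zero left.scale left.sum
  right.add right.diff right.neg right.zero right.scale right.sum

lemma antisymmetric: "B w v = - B v w"
proof -
  have "B (v + w) (v + w) = 0" by (rule alternating)
  then have "B v w + B w v = 0" unfolding left.add right.add by (simp add: alternating add.commute)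
  then show ?thesis by (simp add: eq_neg_iff_add_eq_0 add.commute)
qed

text \<open>
  Non-degeneracy makes \<open>v \<mapsto> \<Sum>\<^sub>b B v b \<cdot> b\<close> an injective, hence surjective endomorphism of the
  finite-dimensional space.
\<close>

lemma functional_representation:
  assumes g: "Vector_Spaces.linear scale (*) g"
  obtains c where "\<And>v. B c v = g v"
proof -
  interpret g: Vector_Spaces.linear scale "(*)" g by fact
  define T where "T v = (\<Sum>b\<in>Basis. scale (B v b) b)" for v
  have T: "Vector_Spaces.linear scale scale T"
    unfolding T_def
    by unfold_locales
      (simp_all add: left.add left.scale scale_left_distrib scale_right_distrib sum.distrib scale_sum_right)
  interpret T: Vector_Spaces.linear scale scale T by (rule T)
  have coeff: "f b = h b" if "(\<Sum>b\<in>Basis. scale (f b) b) = (\<Sum>b\<in>Basis. scale (h b) b)" "b \<in> Basis"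
    for f h b
  proof -
    have "(\<Sum>b\<in>Basis. scale (f b - h b) b) = 0"
      using that(1) by (simp add: scale_left_diff_distrib sum_subtractf)
    then have "f b - h b = 0"
      by (rule independentD[OF independent_Basis finite_Basis subset_refl _ that(2)])
    then show ?thesis by simp
  qed
  have vanish: "w = w'" if "\<And>b. b \<in> Basis \<Longrightarrow> B w b = B w' b" for w w'
  proof -
    have "B w v = B w' v" for v
      using functional.linear_eq_on[OF linear_right linear_right _ that, of v Basis] span_Basis by simp
    then show ?thesis using nondegenerate[of "w - w'"] by (simp add: left.diff)
  qed
  have "inj T" unfolding T_def by (rule injI) (blast intro: vanish coeff)
  then have "surj T" by (rule linear_inj_imp_surj[OF T])
  then obtain c where c: "T c = (\<Sum>b\<in>Basis. scale (g b) b)" by (metis surjD)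
  have "B c v = g v" for v
    using functional.linear_eq_on[OF linear_right g, of v Basis c] coeff[OF c[unfolded T_def]] span_Basis by simp
  then show thesis by (rule that)
qed

lemma lagrangian_subspace: "lagrangian scale B l \<Longrightarrow> subspace l"
  unfolding lagrangian_def by blast

lemma lagrangian_iff: "lagrangian scale B l \<Longrightarrow> v \<in> l \<longleftrightarrow> (\<forall>w\<in>l. B v w = 0)"
  unfolding lagrangian_def by blast

lemma lagrangian_isotropic: "lagrangian scale B l \<Longrightarrow> v \<in> l \<Longrightarrow> w \<in> l \<Longrightarrow> B v w = 0"
  using lagrangian_iff by blast

lemma functional_separates:
  assumes W: "subspace W" and v: "v \<notin> W"
  obtains g where "Vector_Spaces.linear scale (*) g" "\<And>w. w \<in> W \<Longrightarrow> g w = 0" "g v = 1"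
proof -
  obtain C where C: "C \<subseteq> W" "independent C" "W \<subseteq> span C"
    using maximal_independent_subset by blast
  have sC: "span C = W" using span_minimal[OF C(1) W] C(3) by blast
  have "independent (insert v C)" using C(2) v sC independent_insertI by auto
  then obtain g where g: "Vector_Spaces.linear scale (*) g"
      "\<And>x. x \<in> insert v C \<Longrightarrow> g x = (if x = v then 1 else 0)"
    using functional.linear_independent_extend[of "insert v C" "\<lambda>x. if x = v then 1 else 0"] by blast
  have zero: "Vector_Spaces.linear scale ((*) :: 'a \<Rightarrow> _) (\<lambda>_. 0)" by unfold_locales simp_all
  have "g w = 0" if "w \<in> W" for w
  proof (rule functional.linear_eq_on[OF g(1) zero, of _ C])
    show "w \<in> span C" using that sC by simp
    show "g b = 0" if "b \<in> C" for b using g(2)[of b] that v C(1) by auto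
  qed
  moreover have "g v = 1" using g(2)[of v] by simp
  ultimately show thesis using g(1) that by blast
qed

text \<open>
  If \<open>x \<notin> l + m\<close>, then some functional \<open>B c\<close> vanishes on \<open>l + m\<close> but not at \<open>x\<close>.  Since \<open>l\<close> and \<open>m\<close> are
  their own complements, \<open>c \<in> l \<inter> m\<close>, and so \<open>x\<close> is not orthogonal to \<open>l \<inter> m\<close>.
\<close>

lemma lagrangian_sum_if_orthogonal_to_Int:
  assumes l: "lagrangian scale B l" and m: "lagrangian scale B m"
    and x: "\<And>u. u \<in> l \<Longrightarrow> u \<in> m \<Longrightarrow> B x u = 0"
  obtains a b where "a \<in> l" "b \<in> m" "x = a + b"
proof -
  let ?W = "{a + b | a b. a \<in> l \<and> b \<in> m}"
  note sub = lagrangian_subspace[OF l] lagrangian_subspace[OF m]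
  note zero = subspace_0[OF sub(1)] subspace_0[OF sub(2)]
  have W: "subspace ?W" by (rule subspace_sums[OF sub])
  have "x \<in> ?W"
  proof (rule ccontr)
    assume "x \<notin> ?W"
    then obtain g where g: "Vector_Spaces.linear scale (*) g" "\<And>w. w \<in> ?W \<Longrightarrow> g w = 0" "g x = 1"
      using functional_separates[OF W] by blast
    obtain c where c: "\<And>v. B c v = g v" using functional_representation[OF g(1)] by blast
    have "B c w = 0" if "w \<in> l" for w
      unfolding c by (rule g(2)) (use that zero(2) in \<open>force intro: exI[of _ 0]\<close>)
    then have "c \<in> l" by (intro iffD2[OF lagrangian_iff[OF l]] ballI)
    moreover have "B c w = 0" if "w \<in> m" for w
      unfolding c by (rule g(2)) (use that zero(1) in \<open>force intro: exI[of _ 0]\<close>)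
    then have "c \<in> m" by (intro iffD2[OF lagrangian_iff[OF m]] ballI)
    ultimately have "B x c = 0" using x by blast
    then have "g x = 0" using c antisymmetric[of c x] by simp
    then show False using g(3) by simp
  qed
  then show thesis using that by blast
qed

end

section \<open>Families of vectors\<close>

definition single :: "nat \<Rightarrow> 'v::zero \<Rightarrow> nat \<Rightarrow> 'v" where
  "single i v = (\<lambda>j. if j = i then v else 0)"

context symplectic_space
begin

abbreviation "sf \<equiv> scale_family scale"

sublocale family: vector_space sf
  by unfold_locales
    (auto simp: scale_family_def fun_eq_iff scale_right_distrib scale_left_distrib)

lemma subspace_direct_sum:
  assumes "\<And>l. l \<in> set ls \<Longrightarrow> subspace l"
  shows "family.subspace (direct_sum ls)"
proof -
  have "subspace (ls ! i)" if "i < length ls" for i using assms that by simp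
  then show ?thesis
    by (intro family.subspaceI)
      (auto simp: direct_sum_def scale_family_def subspace_0 subspace_add subspace_scale)
qed

lemma finite_span_direct_sum: "\<exists>S. finite S \<and> direct_sum ls \<subseteq> family.span S"
proof (intro exI conjI subsetI)
  let ?n = "length ls"
  let ?S = "(\<lambda>(i, b). single i b) ` ({..<?n} \<times> Basis)"
  show "finite ?S" using finite_Basis by simp
  fix w assume w: "w \<in> direct_sum ls"
  have "single i v \<in> family.span ?S" if i: "i < ?n" for i v
  proof -
    have "v \<in> span Basis" using span_Basis by simp
    then show ?thesis
    proof (induction rule: span_induct_alt)
      case base
      have "single i 0 = (0 :: nat \<Rightarrow> 'v)" by (auto simp: single_def)
      then show ?case using family.span_zero by (simp only:)
    next
      case (step c b y)
      have "single i (scale c b + y) = sf c (single i b) + single i y"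
        by (auto simp: single_def scale_family_def)
      moreover have "single i b \<in> ?S" using i step(1) by force
      ultimately show ?case
        using step(2) by (simp only: family.span_add family.span_scale family.span_base)
    qed
  qed
  moreover have "w = (\<Sum>i<?n. single i (w i))"
  proof
    fix j
    have "(\<Sum>i<m. single i (w i)) j = (if j < m then w j else 0)" for m
      by (induction m) (auto simp: single_def)
    then show "w j = (\<Sum>i<?n. single i (w i)) j"
      using w by (auto simp: direct_sum_def)
  qed
  ultimately show "w \<in> family.span ?S" using family.span_sum by (metis (no_types, lifting) lessThan_iff)
qed

section \<open>The Maslov form in terms of partial sums\<close>

text \<open>
  This is \<open>q(v, w)\<close> for the anti-derivative of \<open>w\<close> that vanishes on the edge \<open>{n - 1, 0}\<close>.
\<close>

definition partial_sum_form :: "nat \<Rightarrow> (nat \<Rightarrow> 'v) \<Rightarrow> (nat \<Rightarrow> 'v) \<Rightarrow> 'a" where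
  "partial_sum_form n v w = (\<Sum>i<n. B (v i) (\<Sum>j\<le>i. w j))"

lemma anti_derivative_partial_sums:
  assumes n: "0 < n" and w: "(\<Sum>i<n. w i) = 0"
  shows "anti_derivative n w (\<lambda>i. \<Sum>j\<le>i. w j)"
  unfolding anti_derivative_def
proof (intro allI impI)
  fix i assume i: "i < n"
  show "(\<Sum>j\<le>i. w j) - (\<Sum>j\<le>(i + n - 1) mod n. w j) = w i"
  proof (cases i)
    case 0
    have "{..n - 1} = {..<n}" using n by auto
    then show ?thesis using 0 n w by simp
  next
    case (Suc k)
    then have "(i + n - 1) mod n = k" using i by simp
    then show ?thesis using Suc by simp
  qed
qed

text \<open>
  Two anti-derivatives differ by a constant vector, which pairs to zero with a family \<open>v\<close> of sum zero.
\<close>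

lemma maslov_form_eq:
  assumes n: "0 < n" and v: "(\<Sum>i<n. v i) = 0" and w: "(\<Sum>i<n. w i) = 0"
  shows "maslov_form B n v w = partial_sum_form n v w"
proof -
  let ?H = "\<lambda>i. \<Sum>j\<le>i. w j"
  define h where "h = (SOME h. anti_derivative n w h)"
  have h: "anti_derivative n w h"
    unfolding h_def by (rule someI[of "anti_derivative n w"]) (rule anti_derivative_partial_sums[OF n w])
  have const: "i < n \<Longrightarrow> h i = ?H i + (h 0 - w 0)" for i
  proof (induction i)
    case (Suc i)
    have "(Suc i + n - 1) mod n = i" using Suc.prems by simp
    then have "h (Suc i) - h i = w (Suc i)" using h Suc.prems unfolding anti_derivative_def by metis
    then have "h (Suc i) = h i + w (Suc i)" by (simp add: algebra_simps)
    then show ?case using Suc by (simp add: algebra_simps)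
  qed simp
  have "maslov_form B n v w = (\<Sum>i<n. B (v i) (h i))"
    unfolding maslov_form_def h_def ..
  also have "\<dots> = (\<Sum>i<n. B (v i) (?H i) + B (v i) (h 0 - w 0))"
    by (intro sum.cong refl) (subst const, simp_all add: right.add)
  also have "\<dots> = partial_sum_form n v w + B (\<Sum>i<n. v i) (h 0 - w 0)"
    by (simp add: sum.distrib left.sum partial_sum_form_def)
  finally show ?thesis by (simp add: v left.zero)
qed

lemma partial_sum_form_add_left:
  "partial_sum_form n (v + v') w = partial_sum_form n v w + partial_sum_form n v' w"
  by (simp add: partial_sum_form_def left.add sum.distrib)

lemma partial_sum_form_add_right:
  "partial_sum_form n v (w + w') = partial_sum_form n v w + partial_sum_form n v w'"
  by (simp add: partial_sum_form_def right.add sum.distrib)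

lemma partial_sum_form_scale_left: "partial_sum_form n (sf c v) w = c * partial_sum_form n v w"
  by (simp add: partial_sum_form_def scale_family_def left.scale sum_distrib_left)

text \<open>
  By antisymmetry of \<open>B\<close>, the difference of the two sides is \<open>B (\<Sum> v) (\<Sum> w)\<close> plus the diagonal terms
  \<open>B (v i) (w i)\<close>.
\<close>

lemma partial_sum_form_sym:
  assumes v: "(\<Sum>i<n. v i) = 0" and diag: "\<And>i. i < n \<Longrightarrow> B (v i) (w i) = 0"
  shows "partial_sum_form n v w = partial_sum_form n w v"
proof -
  have triangle: "(\<Sum>i<n. \<Sum>j\<le>i. b i j + b j i) = (\<Sum>i<n. \<Sum>j<n. b i j) + (\<Sum>i<n. b i i)"
    for b :: "nat \<Rightarrow> nat \<Rightarrow> 'a"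
    by (induction n) (simp_all add: sum.distrib lessThan_Suc_atMost[symmetric] algebra_simps)
  have "partial_sum_form n v w - partial_sum_form n w v
      = (\<Sum>i<n. \<Sum>j\<le>i. B (v i) (w j) + B (v j) (w i))"
    by (simp add: partial_sum_form_def right.sum sum_subtractf[symmetric] antisymmetric[of "w _" "v _"])
  also have "\<dots> = (\<Sum>i<n. \<Sum>j<n. B (v i) (w j)) + (\<Sum>i<n. B (v i) (w i))" by (rule triangle)
  also have "(\<Sum>i<n. \<Sum>j<n. B (v i) (w j)) = B (\<Sum>i<n. v i) (\<Sum>j<n. w j)"
    by (subst left.sum) (simp add: right.sum)
  finally show ?thesis by (simp add: v left.zero diag)
qed

lemma maslov_space_iff:
  "w \<in> maslov_space ls \<longleftrightarrow> w \<in> direct_sum ls \<and> (\<Sum>i<length ls. w i) = 0"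
  unfolding maslov_space_def by simp

lemma maslov_form_on_space:
  assumes "ls \<noteq> []" "v \<in> maslov_space ls" "w \<in> maslov_space ls"
  shows "maslov_form B (length ls) v w = partial_sum_form (length ls) v w"
  using assms by (intro maslov_form_eq) (simp_all add: maslov_space_iff)

lemma subspace_maslov_space:
  assumes "\<And>l. l \<in> set ls \<Longrightarrow> subspace l"
  shows "family.subspace (maslov_space ls)"
proof -
  have "family.subspace (direct_sum ls)" by (rule subspace_direct_sum) (rule assms)
  moreover have "(\<Sum>i<n. sf c x i) = scale c (\<Sum>i<n. x i)" for n c x
    by (simp add: scale_family_def scale_sum_right)
  ultimately show ?thesis
    unfolding maslov_space_def
    by (intro family.subspaceI)
      (simp_all add: family.subspace_0 family.subspace_add family.subspace_scale sum.distrib)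
qed

lemma symmetric_form_maslov:
  assumes ls: "ls \<noteq> []" and l: "\<And>l. l \<in> set ls \<Longrightarrow> lagrangian scale B l"
  shows "symmetric_form sf (maslov_space ls) (maslov_form B (length ls))"
proof -
  have sub: "family.subspace (maslov_space ls)"
    by (rule subspace_maslov_space[OF lagrangian_subspace[OF l]])
  note [simp] = maslov_form_on_space[OF ls] family.subspace_add[OF sub] family.subspace_scale[OF sub]
  show ?thesis
  proof unfold_locales
    show "\<exists>S. finite S \<and> maslov_space ls \<subseteq> family.span S"
      using finite_span_direct_sum[of ls] unfolding maslov_space_def by blast
    show "maslov_form B (length ls) x y = maslov_form B (length ls) y x"
      if "x \<in> maslov_space ls" "y \<in> maslov_space ls" for x y
    proof -
      have "B (x i) (y i) = 0" if i: "i < length ls" for i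
        using lagrangian_isotropic[OF l[OF nth_mem[OF i]]] i
          \<open>x \<in> _\<close> \<open>y \<in> _\<close> by (simp add: maslov_space_iff direct_sum_def)
      then show ?thesis
        using that partial_sum_form_sym[where n = "length ls" and v = x and w = y] by (simp add: maslov_space_iff)
    qed
  qed (simp_all add: sub partial_sum_form_add_left partial_sum_form_scale_left)
qed

section \<open>Triples of Lagrangians\<close>

lemma direct_sum_triple:
  "w \<in> direct_sum [l1, l2, l3] \<longleftrightarrow> w 0 \<in> l1 \<and> w 1 \<in> l2 \<and> w 2 \<in> l3 \<and> (\<forall>i\<ge>3. w i = 0)"
  by (auto simp: direct_sum_def less_Suc_eq numeral_2_eq_2 numeral_3_eq_3)

lemma maslov_space_triple:
  "w \<in> maslov_space [l1, l2, l3] \<longleftrightarrow> w \<in> direct_sum [l1, l2, l3] \<and> w 0 + w 1 + w 2 = 0"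
  by (simp add: maslov_space_iff numeral_2_eq_2)

lemma symmetric_form_kashiwara:
  assumes l: "\<And>l. l \<in> {l1, l2, l3} \<Longrightarrow> lagrangian scale B l"
  shows "symmetric_form sf (direct_sum [l1, l2, l3]) (kashiwara_form B)"
proof unfold_locales
  show "family.subspace (direct_sum [l1, l2, l3])"
    by (rule subspace_direct_sum, rule lagrangian_subspace, rule l) auto
  show "\<exists>S. finite S \<and> direct_sum [l1, l2, l3] \<subseteq> family.span S" by (rule finite_span_direct_sum)
  show "kashiwara_form B x y = kashiwara_form B y x" for x y
    unfolding kashiwara_form_def
    by (simp add: B_simps antisymmetric[of "y _" "x _"])
  show "kashiwara_form B (x + y) z = kashiwara_form B x z + kashiwara_form B y z" for x y z
    unfolding kashiwara_form_def by (simp add: left.add algebra_simps)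
  show "kashiwara_form B (sf c x) z = c * kashiwara_form B x z" for c x z
    unfolding kashiwara_form_def scale_family_def by (simp add: left.scale algebra_simps)
qed

text \<open>
  \<open>U0\<close> is the orthogonal complement of the isotropic summand \<open>l1\<close>.  On it, the summand containing \<open>v 0\<close>
  drops out of Kashiwara's form and the remaining terms combine to \<open>B (v 1) (w 2)\<close>.
\<close>

lemma kashiwara_triple_eq_maslov_index:
  assumes two: "(2 :: 'a) \<noteq> 0" and l: "\<And>l. l \<in> {l1, l2, l3} \<Longrightarrow> lagrangian scale B l"
  shows "witt_class sf (direct_sum [l1, l2, l3]) (kashiwara_form B) = maslov_index scale B [l1, l2, l3]"
proof -
  let ?U = "direct_sum [l1, l2, l3]"
  define U0 where "U0 = {v \<in> ?U. v 1 - v 2 \<in> l1}"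
  define f where "f v = single 0 (v 2 - v 1) + single 1 (v 1) + single 2 (- v 2)" for v :: "nat \<Rightarrow> 'v"
  have f: "f v 0 = v 2 - v 1" "f v (Suc 0) = v 1" "f v 2 = - v 2" "\<And>i. i \<ge> 3 \<Longrightarrow> f v i = 0" for v
    by (auto simp: f_def single_def)
  have L: "lagrangian scale B l1" "lagrangian scale B l2" "lagrangian scale B l3" using l by auto
  note sub = L[THEN lagrangian_subspace]
  obtain A \<phi> where rep: "represented_form sf ?U (kashiwara_form B) A \<phi>"
    using symmetric_form.obtain_representation[OF symmetric_form_kashiwara[OF l]] by blast
  obtain A' \<phi>' where rep': "represented_form sf (maslov_space [l1, l2, l3]) (maslov_form B 3) A' \<phi>'"
  proof -
    have "symmetric_form sf (maslov_space [l1, l2, l3]) (maslov_form B 3)"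
      using symmetric_form_maslov[of "[l1, l2, l3]"] l by (simp add: numeral_3_eq_3)
    then show ?thesis using symmetric_form.obtain_representation that by blast
  qed
  have fU0: "f v \<in> maslov_space [l1, l2, l3]" if "v \<in> U0" for v
    using that subspace_neg[OF sub(1), of "v 1 - v 2"] subspace_neg[OF sub(3), of "v 2"]
    unfolding U0_def maslov_space_triple direct_sum_triple by (auto simp: f)
  have "witt_class sf ?U (kashiwara_form B) = witt_class sf (maslov_space [l1, l2, l3]) (maslov_form B 3)"
  proof (rule witt_class_coisotropic_reduction[OF rep rep'])
    have U: "family.subspace ?U" using rep unfolding represented_form_def represented_form_axioms_def by blast
    show "family.subspace U0"
    proof (rule family.subspaceI)
      show "0 \<in> U0" using family.subspace_0[OF U] subspace_0[OF sub(1)] by (simp add: U0_def)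
      show "x + y \<in> U0" if "x \<in> U0" "y \<in> U0" for x y
        using that family.subspace_add[OF U] subspace_add[OF sub(1), of "x 1 - x 2" "y 1 - y 2"]
        by (simp add: U0_def algebra_simps)
      show "sf c x \<in> U0" if "x \<in> U0" for c x
        using that family.subspace_scale[OF U] subspace_scale[OF sub(1), of "x 1 - x 2" c]
        by (simp add: U0_def scale_family_def scale_right_diff_distrib)
    qed
    show "U0 \<subseteq> ?U" unfolding U0_def by blast
    show "u \<in> U0" if u: "u \<in> ?U" "\<And>x. x \<in> U0 \<Longrightarrow> kashiwara_form B u x = 0" for u
    proof -
      have "B (u 1 - u 2) a = 0" if a: "a \<in> l1" for a
      proof -
        have "single 0 a \<in> U0"
          using a subspace_0[OF sub(1)] subspace_0[OF sub(2)] subspace_0[OF sub(3)]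
          unfolding U0_def direct_sum_triple by (simp add: single_def)
        then have "kashiwara_form B u (single 0 a) = 0" by (rule u(2))
        then have "B (u 2) a - B (u 1) a = 0"
          using two by (simp add: kashiwara_form_def single_def B_simps)
        then show ?thesis by (simp add: left.diff)
      qed
      then have "u 1 - u 2 \<in> l1" using lagrangian_iff[OF L(1)] by blast
      then show ?thesis using u(1) unfolding U0_def by blast
    qed
    show "f ` U0 = maslov_space [l1, l2, l3]"
    proof (intro equalityI subsetI)
      fix w assume w: "w \<in> maslov_space [l1, l2, l3]"
      define v where "v = single 1 (w 1) + single 2 (- w 2)"
      have v: "v 0 = 0" "v (Suc 0) = w 1" "v 2 = - w 2" "\<And>i. i \<ge> 3 \<Longrightarrow> v i = 0"
        by (auto simp: v_def single_def)
      have w0: "w 0 = - (w 1 + w 2)"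
        using w unfolding maslov_space_triple by (metis add.assoc eq_neg_iff_add_eq_0)
      have w3: "\<And>i. i \<ge> 3 \<Longrightarrow> w i = 0" using w unfolding maslov_space_triple direct_sum_triple by blast
      have "w 1 + w 2 \<in> l1"
        using w w0 subspace_neg[OF sub(1), of "w 0"] unfolding maslov_space_triple direct_sum_triple
        by (simp add: add.commute)
      then have "v \<in> U0"
        using w subspace_0[OF sub(1)] subspace_neg[OF sub(3), of "w 2"]
        unfolding U0_def maslov_space_triple direct_sum_triple by (auto simp: v)
      moreover have "w = f v"
      proof
        fix i :: nat
        consider "i = 0" | "i = 1" | "i = 2" | "i \<ge> 3" by linarith
        then show "w i = f v i" by cases (use w0 w3 in \<open>simp_all add: f v\<close>)
      qed
      ultimately show "w \<in> f ` U0" by blast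
    qed (use fU0 in blast)
    show "maslov_form B 3 (f x) (f y) = kashiwara_form B x y" if x: "x \<in> U0" and y: "y \<in> U0" for x y
    proof -
      have "maslov_form B 3 (f x) (f y) = partial_sum_form 3 (f x) (f y)"
        using maslov_form_on_space[OF _ fU0[OF x] fU0[OF y]] by (simp add: numeral_3_eq_3)
      also have "\<dots> = B (f x 0) (f y 0) + B (f x 1) (f y 0 + f y 1) + B (f x 2) (f y 0 + f y 1 + f y 2)"
        unfolding partial_sum_form_def by (simp add: numeral_2_eq_2 numeral_3_eq_3)
      also have "\<dots> = B (x 2 - x 1) (y 2 - y 1) + B (x 1) (y 2)" by (simp add: f right.zero)
      also have "B (x 2 - x 1) (y 2 - y 1) = 0"
      proof (rule lagrangian_isotropic[OF L(1)])
        show "x 2 - x 1 \<in> l1" using subspace_neg[OF sub(1), of "x 1 - x 2"] x by (simp add: U0_def)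
        show "y 2 - y 1 \<in> l1" using subspace_neg[OF sub(1), of "y 1 - y 2"] y by (simp add: U0_def)
      qed
      finally have m: "maslov_form B 3 (f x) (f y) = B (x 1) (y 2)" by simp
      have xU: "x 0 \<in> l1" "x 1 \<in> l2" "x 2 \<in> l3" "x 1 - x 2 \<in> l1"
        and yU: "y 0 \<in> l1" "y 1 \<in> l2" "y 2 \<in> l3" "y 1 - y 2 \<in> l1"
        using x y unfolding U0_def direct_sum_triple by auto
      note iso = lagrangian_isotropic[OF L(1)] lagrangian_isotropic[OF L(2)] lagrangian_isotropic[OF L(3)]
      have 1: "B (x 0) (y 1 - y 2) = 0" using iso(1) xU yU by blast
      have 2: "B (x 2) (y 0) = B (x 1) (y 0)" using iso(1)[OF xU(4) yU(1)] by (simp add: left.diff)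
      have "B (x 1 - x 2) (y 1 - y 2) = 0" using iso(1) xU yU by blast
      then have "- B (x 2) (y 1) = B (x 1) (y 2)"
        unfolding left.diff right.diff iso(2)[OF xU(2) yU(2)] iso(3)[OF xU(3) yU(3)]
        by (simp only: diff_0 diff_0_right right_minus_eq)
      then have 3: "B (x 2) (y 1) = - B (x 1) (y 2)" by (metis minus_minus)
      have "kashiwara_form B x y = 1 / 2 * (B (x 1) (y 2) + B (x 1) (y 2))"
        unfolding kashiwara_form_def 1 by (simp add: right.diff 2 3[unfolded One_nat_def])
      also have "\<dots> = B (x 1) (y 2)" using two by simp
      finally show ?thesis using m by simp
    qed
  qed
  then show ?thesis unfolding maslov_index_def by (simp add: numeral_3_eq_3)
qed

end

section \<open>Cutting a polygon along a diagonal\<close>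

text \<open>
  Cutting along the diagonal from vertex \<open>0\<close> to vertex \<open>m + 1\<close> leaves a piece without the vertices
  \<open>1, \<dots>, m\<close>.  Its vertex \<open>j\<close> is the vertex \<open>skip m j\<close> of the whole polygon, and \<open>spread m\<close> extends a
  family on the piece by zero to the whole polygon.
\<close>

definition spread :: "nat \<Rightarrow> (nat \<Rightarrow> 'v::zero) \<Rightarrow> nat \<Rightarrow> 'v" where
  "spread m v i = (if i = 0 then v 0 else if i \<le> m then 0 else v (i - m))"

definition skip :: "nat \<Rightarrow> nat \<Rightarrow> nat" where
  "skip m j = (if j = 0 then 0 else j + m)"

lemma spread_skip [simp]: "spread m v (skip m j) = v j"
  by (simp add: spread_def skip_def)

lemma spread_add: "spread m (v + w) = spread m v + spread m (w :: nat \<Rightarrow> 'v::ab_group_add)"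
  by (auto simp: spread_def)

lemma sum_skip:
  fixes F :: "nat \<Rightarrow> 'b::comm_monoid_add"
  assumes "\<And>i. 0 < i \<Longrightarrow> i \<le> m \<Longrightarrow> F i = 0"
  shows "(\<Sum>i<Suc (p + m). F i) = (\<Sum>j<Suc p. F (skip m j))"
proof (induction p)
  case 0
  have "(\<Sum>i<m. F (Suc i)) = 0" using assms by (intro sum.neutral) auto
  then show ?case by (simp add: sum.lessThan_Suc_shift skip_def del: sum.lessThan_Suc)
next
  case (Suc p)
  then show ?case by (simp add: skip_def)
qed

lemma sum_spread:
  fixes v :: "nat \<Rightarrow> 'v::ab_group_add"
  shows "(\<Sum>i<Suc (p + m). spread m v i) = (\<Sum>j<Suc p. v j)"
  by (subst sum_skip) (simp_all only: spread_skip, simp add: spread_def)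

lemma partial_sum_spread:
  fixes v :: "nat \<Rightarrow> 'v::ab_group_add"
  shows "(\<Sum>j\<le>i. spread m v j) = (if i \<le> m then v 0 else \<Sum>j\<le>i - m. v j)"
proof (induction i)
  case (Suc i)
  consider "Suc i \<le> m" | "i = m" | "m < i" by linarith
  then show ?case
  proof cases
    case 2
    then show ?thesis using Suc by (simp add: spread_def)
  next
    case 3
    then have "Suc i - m = Suc (i - m)" by simp
    then show ?thesis using Suc 3 by (simp add: spread_def)
  qed (use Suc in \<open>simp_all add: spread_def\<close>)
qed (simp add: spread_def)

context symplectic_space
begin

lemma partial_sum_form_spread:
  "partial_sum_form (Suc (p + m)) (spread m v) (spread m w) = partial_sum_form (Suc p) v w"
proof -
  have "partial_sum_form (Suc (p + m)) (spread m v) (spread m w)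
      = (\<Sum>j<Suc p. B (v j) (\<Sum>i\<le>skip m j. spread m w i))"
    unfolding partial_sum_form_def
    by (subst sum_skip) (simp_all only: spread_skip, simp add: spread_def left.zero)
  also have "\<dots> = partial_sum_form (Suc p) v w"
    unfolding partial_sum_form_def partial_sum_spread by (intro sum.cong refl) (simp add: skip_def)
  finally show ?thesis .
qed

lemma partial_sum_form_truncate:
  assumes "k \<le> n" "\<And>i. k \<le> i \<Longrightarrow> v i = 0"
  shows "partial_sum_form n v w = partial_sum_form k v w"
  unfolding partial_sum_form_def
  by (rule sum.mono_neutral_right) (use assms in \<open>auto simp: left.zero\<close>)

lemma partial_sum_form_spread_right:
  assumes v: "(\<Sum>i<m + 2. v i) = 0" and iso: "B (v (Suc m)) (w 1) = 0"
  shows "partial_sum_form (m + 2) v (spread m w) = 0"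
proof -
  have "partial_sum_form (m + 2) v (spread m w) = B (\<Sum>i<m + 2. v i) (w 0) + B (v (Suc m)) (w 1)"
    unfolding partial_sum_form_def partial_sum_spread
    by (simp add: left.add left.sum right.add algebra_simps)
  then show ?thesis unfolding v iso by (simp add: left.zero)
qed

lemma partial_sum_form_spread_left:
  assumes w: "(\<Sum>i<m + 2. w i) = 0" "\<And>i. m + 2 \<le> i \<Longrightarrow> w i = 0" and iso: "B (v 0) (w 0) = 0"
  shows "partial_sum_form (Suc (p + m)) (spread m v) w = 0"
proof -
  have tail: "(\<Sum>j\<le>i. w j) = 0" if "m < i" for i
  proof -
    have "(\<Sum>j\<le>i. w j) = (\<Sum>j<m + 2. w j)"
      by (rule sum.mono_neutral_right) (use that w(2) in auto)
    then show ?thesis using w(1) by simp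
  qed
  have "B (spread m v i) (\<Sum>j\<le>i. w j) = 0" for i
    using iso tail[of i] by (simp add: spread_def left.zero right.zero not_le)
  then show ?thesis unfolding partial_sum_form_def by simp
qed

text \<open>
  Families on the two pieces are added to give a family on the whole polygon.  This preserves the forms:
  anti-derivatives on the pieces that agree on the diagonal glue to one of the sum, and the correction
  terms at the vertices \<open>0\<close> and \<open>m + 1\<close> vanish because the Lagrangians there are isotropic.  The image
  \<open>D\<close> is coisotropic, so the whole polygon and the product of the pieces both reduce to \<open>D\<close>.
\<close>

lemma maslov_index_cut:
  assumes lag: "\<And>l. l \<in> set ls \<Longrightarrow> lagrangian scale B l"
    and m: "1 \<le> m" "m + 2 < length ls"
    and as_def: "as = take (m + 2) ls" and bs_def: "bs = hd ls # drop (Suc m) ls"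
  shows "maslov_index scale B ls = maslov_index scale B as + maslov_index scale B bs"
proof -
  define n p where "n = length ls" and "p = n - m - 1"
  have n: "n = Suc (p + m)" "2 \<le> p" using m unfolding p_def n_def by auto
  have as: "length as = m + 2" "as \<noteq> []" "\<And>i. i < m + 2 \<Longrightarrow> as ! i = ls ! i"
    using m unfolding as_def by auto
  have bs: "length bs = Suc p" "bs \<noteq> []" using m unfolding bs_def p_def n_def by auto
  have bs_nth: "bs ! j = ls ! skip m j" if "j < Suc p" for j
    using that m unfolding bs_def skip_def p_def n_def by (cases j) (auto simp: hd_conv_nth add.commute[of m] simp flip: length_greater_0_conv)
  have lsne: "ls \<noteq> []" using m by auto
  have lag_as: "lagrangian scale B l" if "l \<in> set as" for l
    using that lag unfolding as_def by (blast dest: in_set_takeD)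
  have lag_bs: "lagrangian scale B l" if "l \<in> set bs" for l
    using that lag lsne unfolding bs_def by (auto dest: in_set_dropD)
  have lag_nth: "lagrangian scale B (ls ! i)" if "i < n" for i
    using lag that unfolding n_def by simp
  note sub_nth = lagrangian_subspace[OF lag_nth]
  let ?K = "maslov_space ls" and ?Ka = "maslov_space as" and ?Kb = "maslov_space bs"
  have K: "w \<in> ?K \<longleftrightarrow> (\<forall>i<n. w i \<in> ls ! i) \<and> (\<forall>i\<ge>n. w i = 0) \<and> (\<Sum>i<n. w i) = 0" for w
    by (auto simp: maslov_space_iff direct_sum_def n_def)
  have Ka: "w \<in> ?Ka \<longleftrightarrow> (\<forall>i<m + 2. w i \<in> ls ! i) \<and> (\<forall>i\<ge>m + 2. w i = 0) \<and> (\<Sum>i<m + 2. w i) = 0" for w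
    using as(3) by (auto simp: maslov_space_iff direct_sum_def as(1))
  have Kb: "w \<in> ?Kb \<longleftrightarrow> (\<forall>j<Suc p. w j \<in> ls ! skip m j) \<and> (\<forall>j\<ge>Suc p. w j = 0) \<and> (\<Sum>j<Suc p. w j) = 0" for w
    using bs_nth by (auto simp: maslov_space_iff direct_sum_def bs(1) simp del: sum.lessThan_Suc)
  let ?q = "maslov_form B n" and ?qa = "maslov_form B (m + 2)" and ?qb = "maslov_form B (Suc p)"
  have formK: "?q v w = partial_sum_form n v w" if "v \<in> ?K" "w \<in> ?K" for v w
    using maslov_form_on_space[OF lsne that] unfolding n_def .
  have formKa: "?qa v w = partial_sum_form (m + 2) v w" if "v \<in> ?Ka" "w \<in> ?Ka" for v w
    using maslov_form_on_space[OF as(2) that] unfolding as(1) .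
  have formKb: "?qb v w = partial_sum_form (Suc p) v w" if "v \<in> ?Kb" "w \<in> ?Kb" for v w
    using maslov_form_on_space[OF bs(2) that] unfolding bs(1) .
  have symK: "symmetric_form sf ?K ?q"
    using symmetric_form_maslov[OF lsne lag] unfolding n_def .
  have symKa: "symmetric_form sf ?Ka ?qa"
    using symmetric_form_maslov[OF as(2) lag_as] unfolding as(1) .
  have symKb: "symmetric_form sf ?Kb ?qb"
    using symmetric_form_maslov[OF bs(2) lag_bs] unfolding bs(1) .
  note subK = symmetric_form.subspace_U[OF symK]
    and subKa = symmetric_form.subspace_U[OF symKa] and subKb = symmetric_form.subspace_U[OF symKb]

  define f where "f x = fst x + spread m (snd x)" for x :: "(nat \<Rightarrow> 'v) \<times> (nat \<Rightarrow> 'v)"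
  have f_in: "f (v, w) \<in> ?K" if v: "v \<in> ?Ka" and w: "w \<in> ?Kb" for v w
  proof -
    have "v \<in> ?K"
    proof -
      have "v i \<in> ls ! i" if "i < n" for i
        using v that subspace_0[OF sub_nth[OF that]] unfolding Ka by (cases "i < m + 2") auto
      moreover have "(\<Sum>i<n. v i) = (\<Sum>i<m + 2. v i)"
        by (rule sum.mono_neutral_right) (use v n in \<open>auto simp: Ka simp del: sum.lessThan_Suc\<close>)
      ultimately show ?thesis using v n unfolding K Ka by (simp del: sum.lessThan_Suc)
    qed
    moreover have "spread m w \<in> ?K"
    proof -
      have "spread m w i \<in> ls ! i" if i: "i < n" for i
      proof -
        consider "i = 0" | "0 < i" "i \<le> m" | "m < i" by linarith
        then show ?thesis
        proof cases
          case 1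
          have "w 0 \<in> ls ! skip m 0" using w unfolding Kb by blast
          then show ?thesis using 1 by (simp add: spread_def skip_def)
        next
          case 2
          then show ?thesis using subspace_0[OF sub_nth[OF i]] by (simp add: spread_def)
        next
          case 3
          then have "i - m < Suc p" "skip m (i - m) = i" using i n by (auto simp: skip_def)
          then have "w (i - m) \<in> ls ! i" using w unfolding Kb by metis
          then show ?thesis using 3 by (simp add: spread_def)
        qed
      qed
      moreover have "spread m w i = 0" if "n \<le> i" for i
        using w that n unfolding Kb by (simp add: spread_def)
      moreover have "(\<Sum>i<n. spread m w i) = (\<Sum>j<Suc p. w j)"
        unfolding n by (rule sum_spread)
      ultimately show ?thesis using w unfolding K Kb by simp
    qed
    ultimately show ?thesis unfolding f_def by (simp add: family.subspace_add[OF subK])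
  qed
  have f_isometry: "?q (f (v, v')) (f (w, w')) = ?qa v w + ?qb v' w'"
    if v: "v \<in> ?Ka" "v' \<in> ?Kb" and w: "w \<in> ?Ka" "w' \<in> ?Kb" for v v' w w'
  proof -
    note vw = v(1)[unfolded Ka] w(1)[unfolded Ka] v(2)[unfolded Kb] w(2)[unfolded Kb]
    have "?q (f (v, v')) (f (w, w'))
        = partial_sum_form n v w + partial_sum_form n v (spread m w')
          + partial_sum_form n (spread m v') w + partial_sum_form n (spread m v') (spread m w')"
      using formK[OF f_in[OF v] f_in[OF w]]
      by (simp only: f_def fst_conv snd_conv partial_sum_form_add_left partial_sum_form_add_right add.assoc)
        (simp only: add.left_commute)
    also have "partial_sum_form n v w = ?qa v w"
      unfolding formKa[OF v(1) w(1)] by (rule partial_sum_form_truncate) (use n vw in auto)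
    also have "partial_sum_form n v (spread m w') = 0"
    proof -
      have "v (Suc m) \<in> ls ! Suc m" using vw(1) by simp
      moreover have "w' 1 \<in> ls ! skip m 1" using vw(4) n(2) by (metis Suc_less_eq One_nat_def less_le_trans zero_less_numeral)
      ultimately have "B (v (Suc m)) (w' 1) = 0"
        using lagrangian_isotropic[OF lag_nth[of "Suc m"]] n by (simp add: skip_def)
      moreover have "partial_sum_form n v (spread m w') = partial_sum_form (m + 2) v (spread m w')"
        by (rule partial_sum_form_truncate) (use n vw in auto)
      ultimately show ?thesis using partial_sum_form_spread_right vw(1) by simp
    qed
    also have "partial_sum_form n (spread m v') w = 0"
    proof -
      have "w 0 \<in> ls ! 0" using vw(2) by simp
      moreover have "v' 0 \<in> ls ! skip m 0" using vw(3) by blast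
      ultimately have "B (v' 0) (w 0) = 0"
        using lagrangian_isotropic[OF lag_nth[of 0]] n by (simp add: skip_def)
      then show ?thesis unfolding n by (intro partial_sum_form_spread_left) (use vw in auto)
    qed
    also have "partial_sum_form n (spread m v') (spread m w') = ?qb v' w'"
      unfolding n(1) partial_sum_form_spread formKb[OF v(2) w(2)] ..
    finally show ?thesis by simp
  qed

  define D where "D = f ` (?Ka \<times> ?Kb)"
  have DK: "D \<subseteq> ?K" unfolding D_def using f_in by auto
  have subD: "family.subspace D"
  proof (rule family.subspaceI)
    have z: "(0, 0) \<in> ?Ka \<times> ?Kb" using family.subspace_0 subKa subKb by blast
    have "f (0, 0) = 0" by (auto simp: f_def spread_def)
    then show "0 \<in> D" unfolding D_def using z by (metis image_eqI)
    show "x + y \<in> D" if "x \<in> D" "y \<in> D" for x y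
    proof -
      obtain v v' w w' where *: "v \<in> ?Ka" "v' \<in> ?Kb" "w \<in> ?Ka" "w' \<in> ?Kb"
        "x = f (v, v')" "y = f (w, w')" using \<open>x \<in> D\<close> \<open>y \<in> D\<close> unfolding D_def by blast
      have "x + y = f (v + w, v' + w')" by (simp add: * f_def spread_add algebra_simps)
      moreover have "(v + w, v' + w') \<in> ?Ka \<times> ?Kb"
        using * family.subspace_add subKa subKb by blast
      ultimately show ?thesis unfolding D_def by blast
    qed
    show "sf c x \<in> D" if "x \<in> D" for c x
    proof -
      obtain v v' where *: "v \<in> ?Ka" "v' \<in> ?Kb" "x = f (v, v')" using \<open>x \<in> D\<close> unfolding D_def by blast
      have "sf c x = f (sf c v, sf c v')"
        by (rule ext) (simp add: * f_def spread_def scale_family_def scale_right_distrib)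
      moreover have "(sf c v, sf c v') \<in> ?Ka \<times> ?Kb"
        using * family.subspace_scale subKa subKb by blast
      ultimately show ?thesis unfolding D_def by blast
    qed
  qed

  have coisotropic: "u \<in> D" if u: "u \<in> ?K" and orth: "\<And>x. x \<in> D \<Longrightarrow> ?q u x = 0" for u
  proof -
    have nm: "0 < n" "Suc m < n" using n by auto
    let ?s = "\<Sum>i<Suc m. u i"
    \<comment> \<open>Testing against families supported on both ends of the diagonal shows that \<open>?s\<close> is orthogonal
      to the intersection of the two Lagrangians there.\<close>
    have "B ?s t = 0" if t: "t \<in> ls ! 0" "t \<in> ls ! Suc m" for t
    proof -
      define v where "v = single 0 t + single (Suc m) (- t)"
      have partial: "(\<Sum>j\<le>i. v j) = (if i < Suc m then t else 0)" for i
        unfolding v_def by (simp add: sum.distrib single_def)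
      have "v \<in> ?Ka"
        unfolding Ka
      proof (intro conjI allI impI)
        fix i assume "i < m + 2"
        then show "v i \<in> ls ! i"
          using t subspace_neg[OF sub_nth[OF nm(2)] t(2)] subspace_0[OF sub_nth[of i]] nm
          by (auto simp: v_def single_def)
      next
        have "{..<m + 2} = {..Suc m}" by auto
        then show "(\<Sum>i<m + 2. v i) = 0" using partial[of "Suc m"] by simp
      qed (auto simp: v_def single_def)
      moreover have "0 \<in> ?Kb" by (rule family.subspace_0[OF subKb])
      moreover have "f (v, 0) = v" by (auto simp: f_def spread_def)
      ultimately have "v \<in> D" unfolding D_def by (metis image_eqI SigmaI)
      then have "partial_sum_form n u v = 0" using orth formK[OF u] DK by (metis subsetD)
      then have "(\<Sum>i<n. B (u i) (if i < Suc m then t else 0)) = 0"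
        unfolding partial_sum_form_def partial .
      also have "(\<Sum>i<n. B (u i) (if i < Suc m then t else 0)) = (\<Sum>i<Suc m. B (u i) t)"
        by (rule sum.mono_neutral_cong_right) (use nm in \<open>auto simp: right.zero\<close>)
      finally show ?thesis unfolding left.sum .
    qed
    then obtain a b where ab: "a \<in> ls ! 0" "b \<in> ls ! Suc m" "?s = a + b"
      using lagrangian_sum_if_orthogonal_to_Int[OF lag_nth[OF nm(1)] lag_nth[OF nm(2)]] by metis
    \<comment> \<open>Moving \<open>a\<close> and \<open>b\<close> from \<open>v\<close> to \<open>w\<close> makes each of the two families sum to zero.\<close>
    define v where "v i = (if i < Suc m then u i - (if i = 0 then a else 0) else if i = Suc m then - b else 0)" for i
    define w where "w j = (u - v) (skip m j)" for j
    have ul: "u i \<in> ls ! i" if "i < n" for i using u that unfolding K by blast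
    have v: "v \<in> ?Ka"
      unfolding Ka
    proof (intro conjI allI impI)
      fix i assume "i < m + 2"
      then show "v i \<in> ls ! i"
        using ul[of i] ab nm subspace_neg[OF sub_nth[OF nm(2)] ab(2)]
          subspace_diff[OF sub_nth[OF nm(1)] ul[OF nm(1)] ab(1)]
        by (auto simp: v_def less_Suc_eq)
    next
      have "(\<Sum>i<m + 2. v i) = (\<Sum>i<Suc m. u i - (if i = 0 then a else 0)) - b"
        by (simp add: v_def)
      also have "\<dots> = ?s - a - b" by (simp add: sum_subtractf del: sum.lessThan_Suc)
      finally show "(\<Sum>i<m + 2. v i) = 0" using ab(3) by simp
    qed (simp add: v_def)
    have uv: "u - v = spread m w"
    proof
      fix i
      consider "i = 0" | "0 < i" "i \<le> m" | "m < i" by linarith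
      then show "(u - v) i = spread m w i"
        by cases (auto simp: spread_def w_def skip_def v_def)
    qed
    have w: "w \<in> ?Kb"
      unfolding Kb
    proof (intro conjI allI impI)
      fix j assume j: "j < Suc p"
      then have lt: "skip m j < n" using n by (auto simp: skip_def)
      consider "j = 0" | "j = 1" | "1 < j" by linarith
      then show "w j \<in> ls ! skip m j"
      proof cases
        case 1
        then show ?thesis using ab by (simp add: w_def skip_def v_def)
      next
        case 2
        then show ?thesis
          using subspace_add[OF sub_nth[OF nm(2)] ul[OF nm(2)] ab(2)] by (simp add: w_def skip_def v_def)
      next
        case 3
        then show ?thesis using ul[OF lt] by (simp add: w_def skip_def v_def)
      qed
    next
      fix j assume "Suc p \<le> j"
      then show "w j = 0" using u n unfolding K by (simp add: w_def skip_def v_def)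
    next
      have "(\<Sum>j<Suc p. w j) = (\<Sum>i<n. spread m w i)"
        unfolding n by (rule sum_spread[symmetric])
      also have "\<dots> = (\<Sum>i<n. u i) - (\<Sum>i<n. v i)"
        unfolding uv[symmetric] by (simp add: sum_subtractf)
      also have "(\<Sum>i<n. v i) = (\<Sum>i<m + 2. v i)"
        by (rule sum.mono_neutral_right) (use n in \<open>auto simp: v_def\<close>)
      finally show "(\<Sum>j<Suc p. w j) = 0"
        using u v unfolding K Ka by (simp del: sum.lessThan_Suc add_2_eq_Suc')
    qed
    have "u = f (v, w)" unfolding f_def by (simp flip: uv)
    then show "u \<in> D" unfolding D_def using v w by blast
  qed

  obtain A \<phi> where rK: "represented_form sf ?K ?q A \<phi>"
    using symmetric_form.obtain_representation[OF symK] by blast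
  obtain A\<^sub>D \<phi>\<^sub>D where rD: "represented_form sf D ?q A\<^sub>D \<phi>\<^sub>D"
    using symmetric_form.obtain_representation[OF symmetric_form.subset[OF symK subD DK]] by blast
  obtain A\<^sub>a \<phi>\<^sub>a where ra: "represented_form sf ?Ka ?qa A\<^sub>a \<phi>\<^sub>a"
    using symmetric_form.obtain_representation[OF symKa] by blast
  obtain A\<^sub>b \<phi>\<^sub>b where rb: "represented_form sf ?Kb ?qb A\<^sub>b \<phi>\<^sub>b"
    using symmetric_form.obtain_representation[OF symKb] by blast
  note rab = represented_form_prod[OF ra rb]
  have "witt_class sf ?K ?q = witt_class sf D ?q"
    by (rule witt_class_coisotropic_reduction[OF rK rD subD DK coisotropic, of "\<lambda>x. x"]) simp_all
  also have "\<dots> = witt_class (scale_prod sf sf) (?Ka \<times> ?Kb) (form_prod ?qa ?qb)"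
  proof (rule witt_class_coisotropic_reduction[OF rab rD, of "?Ka \<times> ?Kb" f, symmetric])
    show "module.subspace (scale_prod sf sf) (?Ka \<times> ?Kb)"
      using rab unfolding represented_form_def represented_form_axioms_def by blast
    show "f ` (?Ka \<times> ?Kb) = D" unfolding D_def ..
    show "?q (f x) (f y) = form_prod ?qa ?qb x y" if "x \<in> ?Ka \<times> ?Kb" "y \<in> ?Ka \<times> ?Kb" for x y
      using that f_isometry by (auto simp: form_prod_def)
  qed simp_all
  also have "\<dots> = witt_class sf ?Ka ?qa + witt_class sf ?Kb ?qb" by (rule witt_class_prod[OF ra rb])
  finally show ?thesis unfolding maslov_index_def as(1) bs(1) n_def .
qed

lemma kashiwara_value_eq_maslov_index:
  assumes two: "(2 :: 'a) \<noteq> 0"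
  shows "kashiwara_value scale B ls x \<Longrightarrow> (\<And>l. l \<in> set ls \<Longrightarrow> lagrangian scale B l) \<Longrightarrow>
    x = maslov_index scale B ls"
proof (induction rule: kashiwara_value.induct)
  case (triple l1 l2 l3)
  then show ?case by (intro kashiwara_triple_eq_maslov_index[OF two]) simp
next
  case (split k ls s t)
  define m where "m = k - 2"
  have k: "k = m + 2" "1 \<le> m" "k - 1 = Suc m" "m + 2 < length ls" using split.hyps(1) unfolding m_def by auto
  have ne: "ls \<noteq> []" using k by auto
  have "s = maslov_index scale B (take k ls)"
    using split.IH(1) split.prems by (blast dest: in_set_takeD)
  moreover have "t = maslov_index scale B (hd ls # drop (k - 1) ls)"
  proof (rule split.IH(2))
    fix l assume "l \<in> set (hd ls # drop (k - 1) ls)"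
    then have "l \<in> set ls" using ne by (auto dest: in_set_dropD)
    then show "lagrangian scale B l" by (rule split.prems)
  qed
  ultimately show ?case
    using maslov_index_cut[OF split.prems k(2,4) refl refl] unfolding k by simp
qed

lemma kashiwara_value_exists: "3 \<le> length ls \<Longrightarrow> \<exists>x. kashiwara_value scale B ls x"
proof (induction "length ls" arbitrary: ls rule: less_induct)
  case less
  have "length (take 3 ls) = 3" using less.prems by simp
  moreover have "\<exists>a b c. xs = [a, b, c]" if "length xs = 3" for xs :: "'v set list"
    using that by (auto simp: length_Suc_conv numeral_3_eq_3)
  ultimately obtain l1 l2 l3 where t3: "take 3 ls = [l1, l2, l3]" by blast
  show ?case
  proof (cases "length ls = 3")
    case True
    then have "ls = [l1, l2, l3]" using t3 by simp
    then show ?thesis using kashiwara_value.triple by blast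
  next
    case False
    let ?bs = "hd ls # drop (3 - 1) ls"
    have "\<exists>x. kashiwara_value scale B ?bs x"
      using False less.prems by (intro less.hyps) auto
    moreover have "\<exists>x. kashiwara_value scale B (take 3 ls) x"
      unfolding t3 using kashiwara_value.triple by blast
    moreover have "3 \<in> {3..length ls - 1}" using False less.prems by auto
    ultimately show ?thesis using kashiwara_value.split by blast
  qed
qed

end

text \<open>
  The recursion attains some value, and all its values equal the Maslov index, which is therefore the
  value that defines Kashiwara's index.
\<close>

theorem proposition11:
  fixes scale :: "'a::field \<Rightarrow> 'v::ab_group_add \<Rightarrow> 'v"
    and Basis :: "'v set"
    and B :: "'v \<Rightarrow> 'v \<Rightarrow> 'a"
    and ls :: "'v set list"
  assumes "CHAR('a) \<noteq> 2"
    and "symplectic_space scale Basis B"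
    and "length ls \<ge> 3"
    and "\<And>l. l \<in> set ls \<Longrightarrow> lagrangian scale B l"
  shows "maslov_index scale B ls = kashiwara_index scale B ls"
proof -
  interpret symplectic_space scale Basis B by fact
  have two: "(2 :: 'a) \<noteq> 0"
  proof
    assume "(2 :: 'a) = 0"
    then have "of_nat 2 = (0 :: 'a)" by simp
    then have "CHAR('a) dvd 2" by (simp only: of_nat_eq_0_iff_char_dvd)
    then have "CHAR('a) = 1 \<or> CHAR('a) = 2" using prime_nat_iff two_is_prime_nat by blast
    then show False using assms(1) by simp
  qed
  note eq = kashiwara_value_eq_maslov_index[OF two _ assms(4)]
  obtain x where "kashiwara_value scale B ls x" using kashiwara_value_exists[OF assms(3)] by blast
  then have "kashiwara_value scale B ls (maslov_index scale B ls)" using eq by metis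
  then have "kashiwara_index scale B ls = maslov_index scale B ls"
    unfolding kashiwara_index_def by (rule the_equality) (rule eq)
  then show ?thesis ..
qed

end
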